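(* Let $N\ge1$, $0<p<q<\infty$ and $\gamma\in(0,\infty]$. There exist constants $C_1,C_2,C_3>0$ depending only on $\gamma,p,q,N$ such that for every cube $Q\subset\mathbb{R}^N$ and every $u\in BMO(Q)$, $$\|u-u_Q\|_{L^{q,\gamma}(Q)}\le C_1\Big\|\min\big\{|u-u_Q|,\|u\|_{BMO(Q)}\big\}\Big\|_{L^{q,\gamma}(Q)}$$ $$\le C_2\sup_{0<s\le \|u\|_{BMO(Q)}^p}\Big[s\,\mathcal{L}^N\big(\{x\in Q:|u(x)-u_Q|^p>s\}\big)\Big]^{\frac1q}\,\|u\|_{BMO(Q)}^{1-\frac pq}\le C_3\,[u-u_Q]_{L^p_w(Q)}^{\frac pq}\,\|u\|_{BMO(Q)}^{1-\frac pq}.$$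
   Context: $\mathcal{L}^N$ is Lebesgue measure. A cube is a Cartesian product of $N$ non-empty closed bounded intervals of the same (positive) length. $u_Q:=\frac{1}{\mathcal{L}^N(Q)}\int_Q u$. For real-valued $u\in L^1(Q)$, $u\in BMO(Q)$ means that $$\|u\|_{BMO(Q)}:=\sup\left\{\frac{1}{\mathcal{L}^N(C)^2}\int_C\int_C|u(z)-u(x)|\,dz\,dx : C\subset Q\text{ a cube}\right\}<\infty .$$ Lorentz quasi-norms (with Lebesgue measure on $X$): for $0<q<\infty$, $$\|f\|_{L^{q,\gamma}(X)}:=\left[\int_0^\infty\big(\mathcal{L}^N(\{x\in X:|f(x)|^q>t\})\big)^{\frac{\gamma}{q}}t^{\frac{\gamma}{q}-1}dt\right]^{1/\gamma}\ (0<\gamma<\infty),$$ $$\|f\|_{L^{q,\infty}(X)}:=\left[\sup_{0<t<\infty}t\,\mathcal{L}^N(\{x\in X:|f(x)|^q>t\})\right]^{1/q},$$ and $[f]_{L^p_w(X)}:=\|f\|_{L^{p,\infty}(X)}$. Conventions: $0\cdot\infty=0\cdot(-\infty)=0$; in particular, if $\|u\|_{BMO(Q)}=0$ the expression containing the supremum over the empty set is $0$. *)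

theory Defs
  imports "HOL-Analysis.Analysis"
begin

definition is_cube :: "(real ^ 'n) set \<Rightarrow> bool" where
  "is_cube C \<longleftrightarrow> (\<exists>(a :: real ^ 'n) l. 0 < l \<and> C = {x. \<forall>i. x $ i \<in> {a $ i .. a $ i + l}})"

definition mean :: "(real ^ 'n) set \<Rightarrow> (real ^ 'n \<Rightarrow> real) \<Rightarrow> real" where
  "mean Q u = (LINT x:Q|lebesgue. u x) / measure lebesgue Q"

definition bmo_norm :: "(real ^ 'n) set \<Rightarrow> (real ^ 'n \<Rightarrow> real) \<Rightarrow> ennreal" where
  "bmo_norm Q u =
     (SUP C \<in> {C. is_cube C \<and> C \<subseteq> Q}.
        (\<integral>\<^sup>+x\<in>C. (\<integral>\<^sup>+z\<in>C. ennreal \<bar>u z - u x\<bar> \<partial>lebesgue) \<partial>lebesgue)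
          / (emeasure lebesgue C)\<^sup>2)"

definition BMO :: "(real ^ 'n) set \<Rightarrow> (real ^ 'n \<Rightarrow> real) set" where
  "BMO Q = {u. set_integrable lebesgue Q u \<and> bmo_norm Q u < \<infinity>}"

text \<open>Powers of extended nonnegative reals; only meaningful for exponents \<open>a > 0\<close>,
  for which \<open>0\<close> is sent to \<open>0\<close> and \<open>\<infinity>\<close> to \<open>\<infinity>\<close>.\<close>

definition epowr :: "ennreal \<Rightarrow> real \<Rightarrow> ennreal" where
  "epowr x a = (if x = \<infinity> then \<infinity> else ennreal (enn2real x powr a))"

definition lorentz_norm ::
    "real \<Rightarrow> ennreal \<Rightarrow> (real ^ 'n) set \<Rightarrow> (real ^ 'n \<Rightarrow> real) \<Rightarrow> ennreal" where
  "lorentz_norm q \<gamma> X f =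
     (if \<gamma> = \<infinity> then
        epowr (SUP t \<in> {0::real<..}.
                 ennreal t * emeasure lebesgue {x \<in> X. \<bar>f x\<bar> powr q > t}) (1 / q)
      else
        epowr (\<integral>\<^sup>+t\<in>{0::real<..}.
                 (epowr (emeasure lebesgue {x \<in> X. \<bar>f x\<bar> powr q > t}) (enn2real \<gamma> / q)
                    * ennreal (t powr (enn2real \<gamma> / q - 1))) \<partial>lborel) (1 / enn2real \<gamma>))"

definition weak_Lp_norm :: "real \<Rightarrow> (real ^ 'n) set \<Rightarrow> (real ^ 'n \<Rightarrow> real) \<Rightarrow> ennreal" where
  "weak_Lp_norm p X f = lorentz_norm p \<infinity> X f"

end

theory Submission
  imports Defs "HOL-Real_Asymp.Real_Asymp"
begin

text \<open>
  Let \<open>B\<close> be the BMO norm of \<open>u\<close>, \<open>f = u - u\<^sub>Q\<close> and \<open>d(t)\<close> the measure of \<open>{\<bar>f\<bar> > t}\<close>. The only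
  inequality with real content is the first one, and it follows from a decay estimate
  \<open>d(t) \<le> c (B/t)\<^sup>r d(B/2)\<close> for \<open>t \<ge> B\<close>, with \<open>r\<close> arbitrary. The decay comes from iterating: if the set
  \<open>{\<bar>f\<bar> > \<alpha>}\<close> fills at most half of \<open>Q\<close>, then \<open>d(\<alpha> + A B) \<le> d(\<alpha>) / 2\<close> where \<open>A\<close> depends on the dimension
  only. Indeed, on a cube that this set fills by at most three quarters, points of \<open>{\<bar>f\<bar> > \<alpha> + A B}\<close> and
  points outside \<open>{\<bar>f\<bar> > \<alpha>}\<close> contribute at least \<open>A B\<close> to the double integral of \<open>\<bar>u(z) - u(x)\<bar>\<close>, so the
  former are rare. The iteration starts at \<open>B/2\<close> if \<open>d(B/2)\<close> is at most half of the measure of \<open>Q\<close>;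
  otherwise it starts at \<open>2B\<close>, by Markov's inequality, and \<open>d(B/2)\<close> is comparable to the measure of \<open>Q\<close>.
\<close>

subsection \<open>Half-open cubes and bisection\<close>

text \<open>Half-open, so that halving every side splits a cube exactly into pairwise disjoint cubes
  of the same kind, with no shared faces to discard.\<close>

definition half_open_cube :: "real ^ 'n \<Rightarrow> real \<Rightarrow> (real ^ 'n) set" where
  "half_open_cube a l = {x. \<forall>i. a $ i \<le> x $ i \<and> x $ i < a $ i + l}"

lemma closed_cube_eq_cbox:
  "{x::real^'n. \<forall>i. x $ i \<in> {a $ i .. a $ i + l}} = cbox a (a + (\<chi> i. l))"
  by (auto simp: mem_box_cart)

lemma box_subset_half_open_cube: "box a (a + (\<chi> i. l)) \<subseteq> half_open_cube a l"
  and half_open_cube_subset_cbox: "half_open_cube a l \<subseteq> cbox a (a + (\<chi> i. l))"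
  by (force simp: half_open_cube_def mem_box_cart less_imp_le)+

lemma measure_cbox_cube:
  assumes "0 \<le> l" shows "measure lebesgue (cbox a (a + (\<chi> i. l)) :: (real^'n) set) = l ^ CARD('n)"
proof -
  have "cbox a (a + (\<chi> i. l)) \<noteq> {}" using assms
    by (auto simp: mem_box_cart intro!: exI[of _ a] simp flip: ex_in_conv)
  then show ?thesis by (simp add: content_cbox_cart)
qed

lemma half_open_cube_lmeasurable [simp]: "half_open_cube a l \<in> lmeasurable"
proof -
  have "half_open_cube a l = {x \<in> space borel. \<forall>i. a $ i \<le> x $ i \<and> x $ i < a $ i + l}"
    by (auto simp: half_open_cube_def)
  also have "\<dots> \<in> sets borel" by measurable
  finally have "half_open_cube a l \<in> sets lebesgue" by auto
  moreover have "bounded (half_open_cube a l)"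
    using half_open_cube_subset_cbox bounded_cbox bounded_subset by blast
  ultimately show ?thesis by (rule bounded_set_imp_lmeasurable[rotated])
qed

lemma half_open_cube_sets [simp]: "half_open_cube a l \<in> sets lebesgue"
  using half_open_cube_lmeasurable by blast

lemma measure_half_open_cube:
  fixes a :: "real^'n" assumes "0 \<le> l"
  shows "measure lebesgue (half_open_cube a l) = l ^ CARD('n)"
proof (rule antisym)
  show "measure lebesgue (half_open_cube a l) \<le> l ^ CARD('n)"
    unfolding measure_cbox_cube[OF assms, of a, symmetric]
    by (intro measure_mono_fmeasurable half_open_cube_subset_cbox) auto
  have "l ^ CARD('n) = measure lebesgue (box a (a + (\<chi> i. l)))"
    unfolding measure_cbox_cube[OF assms, of a, symmetric] by (simp add: measure_lborel_box_eq measure_lborel_cbox_eq)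
  also have "\<dots> \<le> measure lebesgue (half_open_cube a l)"
    by (intro measure_mono_fmeasurable box_subset_half_open_cube) auto
  finally show "l ^ CARD('n) \<le> measure lebesgue (half_open_cube a l)" .
qed

text \<open>\<open>S\<close> collects the coordinates in which the upper half is taken, so the type
  \<open>'n set\<close> enumerates all \<open>2 ^ CARD('n)\<close> children.\<close>

definition child_corner :: "real ^ 'n \<Rightarrow> real \<Rightarrow> 'n set \<Rightarrow> real ^ 'n" where
  "child_corner a l S = (\<chi> i. a $ i + (if i \<in> S then l / 2 else 0))"

lemma half_open_cube_eq_UN_children:
  assumes "0 \<le> l"
  shows "half_open_cube a l = (\<Union>S. half_open_cube (child_corner a l S) (l / 2))"
proof (intro set_eqI iffI)
  fix x assume "x \<in> half_open_cube a l"
  then have "x \<in> half_open_cube (child_corner a l {i. a $ i + l / 2 \<le> x $ i}) (l / 2)"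
    by (simp add: half_open_cube_def child_corner_def not_le add.commute)
  then show "x \<in> (\<Union>S. half_open_cube (child_corner a l S) (l / 2))" by blast
next
  fix x assume "x \<in> (\<Union>S. half_open_cube (child_corner a l S) (l / 2))"
  then obtain S where S: "x \<in> half_open_cube (child_corner a l S) (l / 2)" by blast
  show "x \<in> half_open_cube a l"
    unfolding half_open_cube_def mem_Collect_eq
  proof
    fix i from S show "a $ i \<le> x $ i \<and> x $ i < a $ i + l" using assms
      by (auto simp: half_open_cube_def child_corner_def dest!: spec[of _ i] split: if_splits)
  qed
qed

lemma disjoint_children:
  "disjoint_family (\<lambda>S. half_open_cube (child_corner a l S) (l / 2))"
proof -
  have "S = T" if "x \<in> half_open_cube (child_corner a l S) (l / 2)"
     "x \<in> half_open_cube (child_corner a l T) (l / 2)" for x S T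
  proof (rule set_eqI)
    fix i show "i \<in> S \<longleftrightarrow> i \<in> T" using that
      by (auto simp: half_open_cube_def child_corner_def dest!: spec[of _ i] split: if_splits)
  qed
  then show ?thesis by (auto simp: disjoint_family_on_def)
qed

lemma measure_Int_half_open_cube:
  fixes a :: "real^'n"
  assumes "0 \<le> l" "X \<in> sets lebesgue"
  shows "measure lebesgue (X \<inter> half_open_cube a l) =
    (\<Sum>S\<in>UNIV. measure lebesgue (X \<inter> half_open_cube (child_corner a l S) (l / 2)))"
proof -
  have "X \<inter> half_open_cube a l = (\<Union>S. X \<inter> half_open_cube (child_corner a l S) (l / 2))"
    by (subst half_open_cube_eq_UN_children[OF assms(1)]) auto
  moreover have "measure lebesgue (\<Union>S. X \<inter> half_open_cube (child_corner a l S) (l / 2)) =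
     (\<Sum>S\<in>UNIV. measure lebesgue (X \<inter> half_open_cube (child_corner a l S) (l / 2)))"
    using disjoint_children[of a l] assms(2)
    by (intro measure_UNION')
      (auto simp: disjoint_family_on_def pairwise_def disjnt_def intro: fmeasurable_Int_fmeasurable
        intro!: fmeasurableI2[OF half_open_cube_lmeasurable])
  ultimately show ?thesis by simp
qed

lemma dist_half_open_cube:
  fixes a :: "real^'n" and l :: real
  assumes "x \<in> half_open_cube a l" "y \<in> half_open_cube a l"
  shows "dist x y \<le> CARD('n) * l"
proof -
  have "dist x y \<le> (\<Sum>i\<in>UNIV. \<bar>(x - y) $ i\<bar>)" unfolding dist_norm by (rule norm_le_l1_cart)
  also have "\<dots> \<le> (\<Sum>i\<in>(UNIV::'n set). l)"
  proof (rule sum_mono)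
    fix i show "\<bar>(x - y) $ i\<bar> \<le> l" using assms
      by (auto simp: half_open_cube_def abs_le_iff dest!: spec[of _ i])
  qed
  finally show ?thesis by simp
qed

text \<open>A stopping-time argument without a covering or density theorem: a sufficiently small cube that
  meets the compact set lies inside the open set, so the claim is vacuous there, and it propagates from
  the \<open>2\<^sup>n\<close> children to their parent.\<close>

lemma compact_half_of_open_by_bisection:
  fixes K U :: "(real ^ 'n) set"
  assumes "compact K" "open U" "K \<subseteq> U"
    and osc: "\<And>a l. 0 < l \<Longrightarrow> half_open_cube a l \<subseteq> Q \<Longrightarrow>
        measure lebesgue (U \<inter> half_open_cube a l) \<le> 3 / 4 * l ^ CARD('n) \<Longrightarrow>
        measure lebesgue (K \<inter> half_open_cube a l) \<le> 3 / 8 * (l / 2) ^ CARD('n)"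
    and "0 < l" "half_open_cube a l \<subseteq> Q"
      "measure lebesgue (U \<inter> half_open_cube a l) \<le> 3 / 4 * l ^ CARD('n)"
  shows "measure lebesgue (K \<inter> half_open_cube a l) \<le> 1 / 2 * measure lebesgue (U \<inter> half_open_cube a l)"
proof -
  obtain e where e: "e > 0" "(\<Union>x\<in>K. ball x e) \<subseteq> U"
    using compact_subset_open_imp_ball_epsilon_subset assms(1-3) by blast
  \<comment> \<open>By \<open>dist_half_open_cube\<close>, a cube of side at most
    \<open>\<delta>\<close> has diameter below \<open>e\<close>, so it lies in
    \<open>ball x e\<close> for each of its points \<open>x\<close>.\<close>
  define \<delta> where "\<delta> = e / (CARD('n) + 1)"
  have "\<delta> > 0" using e by (simp add: \<delta>_def)
  have [measurable]: "K \<in> sets lebesgue" "U \<in> sets lebesgue"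
    using assms(1,2) by (auto simp: borel_compact)
  \<comment> \<open>Induction on the scale: \<open>k\<close> bounds the number of halvings that
    bring the side down to \<open>\<delta>\<close>. The cube stays arbitrary because the step passes
    to the children.\<close>
  have claim: "measure lebesgue (K \<inter> half_open_cube a l) \<le> 1 / 2 * measure lebesgue (U \<inter> half_open_cube a l)"
    if "l \<le> 2 ^ k * \<delta>" "0 < l" "half_open_cube a l \<subseteq> Q"
      "measure lebesgue (U \<inter> half_open_cube a l) \<le> 3 / 4 * l ^ CARD('n)" for a l k
    using that
  proof (induction k arbitrary: a l)
    case 0
    have "K \<inter> half_open_cube a l = {}"
    proof (rule ccontr)
      assume "K \<inter> half_open_cube a l \<noteq> {}"
      then obtain x where x: "x \<in> K" "x \<in> half_open_cube a l" by blast
      have "half_open_cube a l \<subseteq> ball x e"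
      proof
        fix y assume "y \<in> half_open_cube a l"
        then have "dist x y \<le> CARD('n) * l" using dist_half_open_cube x by blast
        also have "\<dots> \<le> CARD('n) * \<delta>" using 0 by (intro mult_left_mono) auto
        also have "\<dots> < e" using e by (simp add: \<delta>_def field_simps)
        finally show "y \<in> ball x e" by simp
      qed
      \<comment> \<open>\<open>U\<close> would fill the whole cube, against the bound of three
        quarters.\<close>
      then have "U \<inter> half_open_cube a l = half_open_cube a l" using e x by blast
      then show False using 0 by (simp add: measure_half_open_cube)
    qed
    then show ?case by simp
  next
    case (Suc k)
    let ?c = "\<lambda>S. half_open_cube (child_corner a l S) (l / 2)"
    have sub: "?c S \<subseteq> half_open_cube a l" for S
      using half_open_cube_eq_UN_children[of l a] Suc.prems by auto
    have "measure lebesgue (K \<inter> ?c S) \<le> 1 / 2 * measure lebesgue (U \<inter> ?c S)" for S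
    proof (cases "measure lebesgue (U \<inter> ?c S) \<le> 3 / 4 * (l / 2) ^ CARD('n)")
      case True
      then show ?thesis using Suc.prems sub[of S] by (intro Suc.IH) auto
    next
      \<comment> \<open>\<open>U\<close> fills more than three quarters of this child, while
        \<open>osc\<close> on the parent bounds \<open>K\<close> by three eighths of the child's
        volume, which is half of that.\<close>
      case False
      have "measure lebesgue (K \<inter> ?c S) \<le> measure lebesgue (K \<inter> half_open_cube a l)"
        using sub[of S]
        by (intro measure_mono_fmeasurable) (auto intro!: fmeasurableI2[OF half_open_cube_lmeasurable])
      also have "\<dots> \<le> 3 / 8 * (l / 2) ^ CARD('n)" using Suc.prems by (intro osc) auto
      finally show ?thesis using False by linarith
    qed
    then have "(\<Sum>S\<in>UNIV. measure lebesgue (K \<inter> ?c S)) \<le> (\<Sum>S\<in>UNIV. 1 / 2 * measure lebesgue (U \<inter> ?c S))"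
      by (intro sum_mono) auto
    then show ?case using Suc.prems
      by (simp add: measure_Int_half_open_cube[of l _ a] sum_distrib_left)
  qed
  obtain k where "l / \<delta> < 2 ^ k" using real_arch_pow[of 2 "l / \<delta>"] by auto
  then have "l \<le> 2 ^ k * \<delta>" using \<open>\<delta> > 0\<close> by (simp add: field_simps)
  then show ?thesis using claim assms by blast
qed

subsection \<open>Decay of superlevel sets\<close>

text \<open>Restrict the double integral to \<open>x\<close> in \<open>F\<close> and
  \<open>z\<close> in \<open>G\<close>, where the integrand is at least \<open>h\<close>.\<close>

lemma oscillation_product_bound:
  fixes v :: "real^'n \<Rightarrow> real"
  assumes int: "(\<integral>\<^sup>+x\<in>C. (\<integral>\<^sup>+z\<in>C. ennreal \<bar>v z - v x\<bar> \<partial>lebesgue) \<partial>lebesgue) \<le> ennreal B * (emeasure lebesgue C)\<^sup>2"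
    and C: "C \<in> lmeasurable" and FG [measurable]: "F \<in> sets lebesgue" "G \<in> sets lebesgue"
    and sub: "F \<subseteq> C" "G \<subseteq> C"
    and h: "0 \<le> h" "0 \<le> B" "\<And>x z. x \<in> F \<Longrightarrow> z \<in> G \<Longrightarrow> h \<le> \<bar>v z - v x\<bar>"
  shows "h * measure lebesgue F * measure lebesgue G \<le> B * (measure lebesgue C)\<^sup>2"
proof -
  have FGm: "F \<in> lmeasurable" "G \<in> lmeasurable" using C sub FG by (auto intro: fmeasurableI2)
  have "ennreal (h * measure lebesgue F * measure lebesgue G) = ennreal h * emeasure lebesgue G * emeasure lebesgue F"
    using h by (simp add: emeasure_eq_measure2[OF FGm(1)] emeasure_eq_measure2[OF FGm(2)] ennreal_mult mult_ac)
  also have "\<dots> = (\<integral>\<^sup>+x. ennreal h * emeasure lebesgue G * indicator F x \<partial>lebesgue)"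
    by (simp add: nn_integral_cmult)
  also have "\<dots> \<le> (\<integral>\<^sup>+x\<in>C. (\<integral>\<^sup>+z\<in>C. ennreal \<bar>v z - v x\<bar> \<partial>lebesgue) \<partial>lebesgue)"
  proof (intro nn_integral_mono)
    fix x :: "real^'n"
    show "ennreal h * emeasure lebesgue G * indicator F x
        \<le> (\<integral>\<^sup>+z\<in>C. ennreal \<bar>v z - v x\<bar> \<partial>lebesgue) * indicator C x"
    proof (cases "x \<in> F")
      case True
      have "ennreal h * emeasure lebesgue G = (\<integral>\<^sup>+z. ennreal h * indicator G z \<partial>lebesgue)"
        by (simp add: nn_integral_cmult)
      also have "\<dots> \<le> (\<integral>\<^sup>+z\<in>C. ennreal \<bar>v z - v x\<bar> \<partial>lebesgue)"
        using sub h True by (intro nn_integral_mono) (auto simp: indicator_def intro!: ennreal_leI)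
      finally show ?thesis using True sub by (auto simp: indicator_def)
    qed simp
  qed
  also note int
  also have "ennreal B * (emeasure lebesgue C)\<^sup>2 = ennreal (B * (measure lebesgue C)\<^sup>2)"
    using h by (simp add: emeasure_eq_measure2[OF C] ennreal_mult ennreal_power)
  finally show ?thesis using h by (simp add: ennreal_le_iff)
qed

text \<open>Bisection yields half-open cubes, whereas the oscillation bound concerns closed ones. A
  closed \<open>Q\<close> also contains the closure of the open box.\<close>

lemma cbox_subset_closed_if_half_open_cube_subset:
  assumes "0 < l" "half_open_cube a l \<subseteq> Q" "closed Q"
  shows "cbox a (a + (\<chi> i. l)) \<subseteq> Q"
proof -
  have "box a (a + (\<chi> i. l)) \<noteq> {}" using assms(1)
    by (auto simp: mem_box_cart intro!: exI[of _ "a + (\<chi> i. l / 2)"] simp flip: ex_in_conv)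
  then have "cbox a (a + (\<chi> i. l)) = closure (box a (a + (\<chi> i. l)))" by (simp add: closure_box)
  also have "\<dots> \<subseteq> Q" using assms box_subset_half_open_cube by (intro closure_minimal) blast+
  finally show ?thesis .
qed

text \<open>Comparing a cube with the values of \<open>v\<close> off a majorising open set, rather than with its
  mean, is what lets the threshold \<open>\<alpha>\<close> be smaller than the average of \<open>\<bar>v\<bar>\<close>.\<close>

lemma superlevel_set_halving:
  fixes v :: "real^'n \<Rightarrow> real"
  assumes osc: "\<And>a l. 0 < l \<Longrightarrow> cbox a (a + (\<chi> i. l)) \<subseteq> Q \<Longrightarrow>
     (\<integral>\<^sup>+x\<in>cbox a (a + (\<chi> i. l)). (\<integral>\<^sup>+z\<in>cbox a (a + (\<chi> i. l)). ennreal \<bar>v z - v x\<bar> \<partial>lebesgue) \<partial>lebesgue)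
       \<le> ennreal B * (emeasure lebesgue (cbox a (a + (\<chi> i. l))))\<^sup>2"
    and Q: "Q = cbox a0 (a0 + (\<chi> i. L))" "0 < L" and "0 < B"
    and meas: "\<And>t. {x\<in>Q. t < \<bar>v x\<bar>} \<in> sets lebesgue"
    and half: "measure lebesgue {x\<in>Q. \<alpha> < \<bar>v x\<bar>} \<le> measure lebesgue Q / 2"
  shows "measure lebesgue {x\<in>Q. \<alpha> + 2 ^ (CARD('n) + 4) * B < \<bar>v x\<bar>} \<le> measure lebesgue {x\<in>Q. \<alpha> < \<bar>v x\<bar>} / 2"
proof -
  define A :: real where "A = 2 ^ (CARD('n) + 4)"
  define E where "E = {x\<in>Q. \<alpha> < \<bar>v x\<bar>}"
  define F where "F = {x\<in>Q. \<alpha> + A * B < \<bar>v x\<bar>}"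
  have A: "0 < A" by (simp add: A_def)
  have Qm: "Q \<in> lmeasurable" by (simp add: Q)
  have Em: "E \<in> lmeasurable" and Fm: "F \<in> lmeasurable"
    using meas Qm by (auto simp: E_def F_def intro: fmeasurableI2)
  have "measure lebesgue F \<le> measure lebesgue E / 2 + \<epsilon>" if "0 < \<epsilon>" for \<epsilon>
  proof -
    \<comment> \<open>The bound by \<open>\<epsilon> / 2\<close> absorbs the total error of 3/2
      times \<open>\<eta>\<close> from the two approximations. The bound by a quarter of the volume
      keeps \<open>U\<close> within 1/2 + 1/4 = 3/4 of the cube.\<close>
    define \<eta> where "\<eta> = min (\<epsilon> / 2) (L ^ CARD('n) / 4)"
    have \<eta>: "0 < \<eta>" "\<eta> \<le> \<epsilon> / 2" "\<eta> \<le> L ^ CARD('n) / 4" using that Q by (auto simp: \<eta>_def)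
    obtain U where U: "open U" "E \<subseteq> U" "U - E \<in> lmeasurable" "emeasure lebesgue (U - E) < ennreal \<eta>"
      using sets_lebesgue_outer_open[of E \<eta>] Em \<eta> by blast
    obtain K where K: "closed K" "K \<subseteq> F" "F - K \<in> lmeasurable" "emeasure lebesgue (F - K) < ennreal \<eta>"
      using sets_lebesgue_inner_closed[of F \<eta>] Fm \<eta> by blast
    have "compact K" using K Q unfolding compact_eq_bounded_closed F_def
      by (auto intro: bounded_subset[OF bounded_cbox])
    have FE: "F \<subseteq> E" using A \<open>0 < B\<close> by (auto simp: E_def F_def) (smt (verit) mult_pos_pos)
    have Us: "U \<in> sets lebesgue" using U(1) by auto
    have Km: "K \<in> lmeasurable" using \<open>compact K\<close> by (rule lmeasurable_compact)
    have mU: "measure lebesgue (U - E) \<le> \<eta>"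
      using U(4) \<eta> by (simp add: emeasure_eq_measure2[OF U(3)] ennreal_less_iff)
    have mK: "measure lebesgue (F - K) \<le> \<eta>"
      using K(4) \<eta> by (simp add: emeasure_eq_measure2[OF K(3)] ennreal_less_iff)
    let ?H = "half_open_cube a0 L"
    have HQ: "?H \<subseteq> Q" using Q half_open_cube_subset_cbox by blast
    have UH: "measure lebesgue (U \<inter> ?H) \<le> measure lebesgue E + \<eta>"
    proof -
      have "measure lebesgue (U \<inter> ?H) \<le> measure lebesgue (E \<union> (U - E))"
        using Us fmeasurable.Un[OF Em U(3)] by (intro measure_mono_fmeasurable) auto
      also have "\<dots> \<le> measure lebesgue E + measure lebesgue (U - E)"
        by (rule measure_Un_le) (use Em U(3) in auto)
      finally show ?thesis using mU by simp
    qed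
    have mQ: "measure lebesgue Q = L ^ CARD('n)" unfolding Q(1) using Q(2) by (intro measure_cbox_cube) auto
    have step: "measure lebesgue (K \<inter> half_open_cube a l) \<le> 3 / 8 * (l / 2) ^ CARD('n)"
      if H: "0 < l" "half_open_cube a l \<subseteq> Q"
        "measure lebesgue (U \<inter> half_open_cube a l) \<le> 3 / 4 * l ^ CARD('n)" for a l
    proof -
      let ?J = "half_open_cube a l" and ?C = "cbox a (a + (\<chi> i. l))"
      have CQ: "?C \<subseteq> Q"
        using cbox_subset_closed_if_half_open_cube_subset[OF H(1,2)] Q by auto
      have JC: "?J \<subseteq> ?C" by (rule half_open_cube_subset_cbox)
      have mC: "measure lebesgue ?C = l ^ CARD('n)" using H(1) by (intro measure_cbox_cube) auto
      have mJ: "measure lebesgue ?J = l ^ CARD('n)" using H(1) by (simp add: measure_half_open_cube)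
      \<comment> \<open>The product bound with height \<open>A * B\<close>; the factor
        \<open>B\<close> then cancels, which leaves an estimate free of the BMO norm.\<close>
      have "A * B * measure lebesgue (K \<inter> ?J) * measure lebesgue (?J - U) \<le> B * (measure lebesgue ?C)\<^sup>2"
      proof (rule oscillation_product_bound[OF osc[OF H(1) CQ]])
        fix x z assume xz: "x \<in> K \<inter> ?J" "z \<in> ?J - U"
        then have "\<alpha> + A * B < \<bar>v x\<bar>" using K(2) by (auto simp: F_def)
        moreover have "\<bar>v z\<bar> \<le> \<alpha>" using xz U(2) H(2) by (force simp: E_def not_less[symmetric])
        ultimately show "A * B \<le> \<bar>v z - v x\<bar>" by linarith
      qed (use JC Km Us A \<open>0 < B\<close> in auto)
      then have 1: "A * measure lebesgue (K \<inter> ?J) * measure lebesgue (?J - U) \<le> (l ^ CARD('n))\<^sup>2"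
        using \<open>0 < B\<close> by (simp add: mC mult_ac)
      have "measure lebesgue (?J - U) = measure lebesgue ?J - measure lebesgue (U \<inter> ?J)"
      proof -
        have "measure lebesgue (?J - U \<inter> ?J) = measure lebesgue ?J - measure lebesgue (U \<inter> ?J)"
          using Us by (intro measurable_measure_Diff) auto
        then show ?thesis by (simp add: Diff_Int)
      qed
      then have 2: "l ^ CARD('n) / 4 \<le> measure lebesgue (?J - U)" using H(3) mJ by simp
      have "A * measure lebesgue (K \<inter> ?J) * (l ^ CARD('n) / 4) \<le> (l ^ CARD('n))\<^sup>2"
        by (rule order_trans[OF mult_left_mono[OF 2] 1]) (use A in auto)
      then have "A * measure lebesgue (K \<inter> ?J) \<le> 4 * l ^ CARD('n)"
        using H(1) by (simp add: power2_eq_square)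
      \<comment> \<open>This fixes the exponent in \<open>A\<close>: the factor
        \<open>2 ^ CARD('n)\<close> pays for passing to the volume of a child, and the remaining 16
        turns 4 into 1/4, below the required 3/8.\<close>
      then have "measure lebesgue (K \<inter> ?J) \<le> 1 / 4 * (l / 2) ^ CARD('n)"
        using H(1) by (simp add: A_def power_add power_divide field_simps)
      moreover have "0 \<le> (l / 2) ^ CARD('n)" using H(1) by simp
      ultimately show ?thesis by linarith
    qed
    have "measure lebesgue (K \<inter> ?H) \<le> 1 / 2 * measure lebesgue (U \<inter> ?H)"
    proof (rule compact_half_of_open_by_bisection[OF \<open>compact K\<close> U(1) _ step Q(2) HQ])
      show "K \<subseteq> U" using K U FE by blast
      show "measure lebesgue (U \<inter> ?H) \<le> 3 / 4 * L ^ CARD('n)"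
        using UH half \<eta>(3) mQ unfolding E_def by simp
    qed
    \<comment> \<open>The closed and the half-open cube have equal volume, so the faces that
      \<open>?H\<close> misses are null.\<close>
    moreover have "measure lebesgue K \<le> measure lebesgue (K \<inter> ?H)"
    proof -
      have "measure lebesgue (Q - ?H) = 0"
        using measurable_measure_Diff[OF Qm _ HQ] Q(2) by (simp add: mQ measure_half_open_cube)
      moreover have "measure lebesgue K \<le> measure lebesgue ((K \<inter> ?H) \<union> (Q - ?H))"
        using K(2) Km Qm by (intro measure_mono_fmeasurable fmeasurable.Un fmeasurable_Diff) (auto simp: F_def intro: fmeasurableI2)
      moreover have "\<dots> \<le> measure lebesgue (K \<inter> ?H) + measure lebesgue (Q - ?H)"
        by (rule measure_Un_le) (use Km Qm in auto)
      ultimately show ?thesis by simp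
    qed
    moreover have "measure lebesgue F \<le> measure lebesgue K + \<eta>"
    proof -
      have "measure lebesgue F \<le> measure lebesgue (K \<union> (F - K))"
        using Fm Km K(3) by (intro measure_mono_fmeasurable) auto
      also have "\<dots> \<le> measure lebesgue K + measure lebesgue (F - K)"
        by (rule measure_Un_le) (use Km K(3) in auto)
      finally show ?thesis using mK by simp
    qed
    ultimately show ?thesis using UH \<eta>(1,2) by simp
  qed
  then have "measure lebesgue F \<le> measure lebesgue E / 2" by (rule field_le_epsilon)
  then show ?thesis by (simp add: E_def F_def A_def)
qed

section \<open>Oscillation on cubes and deviation from the mean\<close>

lemma is_cubeE:
  assumes "is_cube C"
  obtains a l where "0 < l" "C = cbox a (a + (\<chi> i. l))"
  using assms unfolding is_cube_def closed_cube_eq_cbox by blast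

lemma is_cube_cbox: "0 < l \<Longrightarrow> is_cube (cbox a (a + (\<chi> i. l)))"
  unfolding is_cube_def closed_cube_eq_cbox by blast

lemma is_cube_lmeasurable: "is_cube C \<Longrightarrow> C \<in> lmeasurable"
  by (auto elim: is_cubeE)

lemma is_cube_measure_pos: "is_cube C \<Longrightarrow> 0 < measure lebesgue C"
  by (elim is_cubeE) (simp only: measure_cbox_cube less_imp_le zero_less_power)

text \<open>Undoes the division in the definition of the norm, which is legitimate because a cube
  has positive finite measure; membership in \<open>BMO Q\<close> makes the norm a real
  number.\<close>

lemma BMO_oscillation:
  assumes "u \<in> BMO Q" "is_cube C" "C \<subseteq> Q"
  shows "(\<integral>\<^sup>+x\<in>C. (\<integral>\<^sup>+z\<in>C. ennreal \<bar>u z - u x\<bar> \<partial>lebesgue) \<partial>lebesgue)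
    \<le> ennreal (enn2real (bmo_norm Q u)) * (emeasure lebesgue C)\<^sup>2"
proof -
  let ?I = "\<integral>\<^sup>+x\<in>C. (\<integral>\<^sup>+z\<in>C. ennreal \<bar>u z - u x\<bar> \<partial>lebesgue) \<partial>lebesgue"
  have "?I / (emeasure lebesgue C)\<^sup>2 \<le> bmo_norm Q u"
    unfolding bmo_norm_def by (rule SUP_upper) (use assms in auto)
  then have "?I / (emeasure lebesgue C)\<^sup>2 * (emeasure lebesgue C)\<^sup>2 \<le> bmo_norm Q u * (emeasure lebesgue C)\<^sup>2"
    by (rule mult_right_mono) simp
  moreover have "(emeasure lebesgue C)\<^sup>2 / (emeasure lebesgue C)\<^sup>2 = 1"
    using is_cube_measure_pos[OF assms(2)]
    by (intro ennreal_divide_self)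
      (auto simp: emeasure_eq_measure2[OF is_cube_lmeasurable[OF assms(2)]] ennreal_power)
  moreover have "bmo_norm Q u = ennreal (enn2real (bmo_norm Q u))"
    using assms(1) by (auto simp: BMO_def)
  ultimately show ?thesis by (simp add: ennreal_divide_times)
qed

text \<open>Integrability on \<open>Q\<close> controls only the product of \<open>u\<close> with the
  indicator of \<open>Q\<close>, so measurability is read off from that product and the set is then
  cut down to \<open>Q\<close>.\<close>

lemma set_integrable_superlevel_sets:
  fixes u :: "'a::euclidean_space \<Rightarrow> real"
  assumes "set_integrable lebesgue Q u" "Q \<in> sets lebesgue"
  shows "{x\<in>Q. t < \<bar>u x - m\<bar>} \<in> sets lebesgue"
proof -
  define v where "v = (\<lambda>x. indicator Q x *\<^sub>R u x)"
  have [measurable]: "v \<in> borel_measurable lebesgue"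
    using assms(1) by (auto simp: set_integrable_def v_def)
  have "{x\<in>Q. t < \<bar>u x - m\<bar>} = Q \<inter> {x \<in> space lebesgue. t < \<bar>v x - m\<bar>}"
    by (auto simp: v_def)
  also have "{x \<in> space lebesgue. t < \<bar>v x - m\<bar>} \<in> sets lebesgue" by measurable
  then have "Q \<inter> {x \<in> space lebesgue. t < \<bar>v x - m\<bar>} \<in> sets lebesgue" using assms(2) by blast
  finally show ?thesis .
qed

text \<open>The difference between \<open>u x\<close> and the mean is the average over
  \<open>z\<close> of \<open>u x - u z\<close>. Taking absolute values inside and integrating over
  \<open>x\<close> gives the double integral in \<open>osc\<close>.\<close>

lemma integral_deviation_from_mean_le:
  fixes u :: "real^'n \<Rightarrow> real"
  assumes int: "set_integrable lebesgue Q u" and Qm: "Q \<in> lmeasurable" "0 < measure lebesgue Q"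
    and osc: "(\<integral>\<^sup>+x\<in>Q. (\<integral>\<^sup>+z\<in>Q. ennreal \<bar>u z - u x\<bar> \<partial>lebesgue) \<partial>lebesgue) \<le> ennreal B * (emeasure lebesgue Q)\<^sup>2"
  shows "(\<integral>\<^sup>+x\<in>Q. ennreal \<bar>u x - mean Q u\<bar> \<partial>lebesgue) \<le> ennreal B * emeasure lebesgue Q"
proof -
  let ?m = "measure lebesgue Q"
  have [measurable]: "(\<lambda>x. indicator Q x *\<^sub>R u x) \<in> borel_measurable lebesgue"
    using int by (auto simp: set_integrable_def)
  have [measurable]: "Q \<in> sets lebesgue" using Qm by auto
  have eQ: "emeasure lebesgue Q = ennreal ?m" using Qm by (simp add: emeasure_eq_measure2)
  have pw: "ennreal ?m * ennreal \<bar>u x - mean Q u\<bar> \<le> (\<integral>\<^sup>+z\<in>Q. ennreal \<bar>u z - u x\<bar> \<partial>lebesgue)" for x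
  proof -
    have c: "set_integrable lebesgue Q (\<lambda>z. u x)"
      unfolding set_integrable_def using Qm by (intro integrable_scaleR_left integrable_real_indicator) (auto simp: fmeasurable_def)
    have d: "set_integrable lebesgue Q (\<lambda>z. u z - u x)" using int c by (rule set_integral_diff)
    have "(LINT z:Q|lebesgue. u z - u x) = (LINT z:Q|lebesgue. u z) - (LINT z:Q|lebesgue. u x)"
      using int c by (rule set_integral_diff)
    also have "(LINT z:Q|lebesgue. u x) = u x * ?m"
      by (simp add: set_lebesgue_integral_def)
    also have "(LINT z:Q|lebesgue. u z) = mean Q u * ?m" using Qm by (simp add: mean_def)
    finally have "\<bar>u x - mean Q u\<bar> * ?m = norm (LINT z:Q|lebesgue. u z - u x)"
      using Qm by (simp add: abs_mult abs_minus_commute flip: left_diff_distrib)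
    also have "ennreal \<dots> \<le> (\<integral>\<^sup>+z. ennreal (norm (indicator Q z *\<^sub>R (u z - u x))) \<partial>lebesgue)"
      unfolding set_lebesgue_integral_def
      by (rule integral_norm_bound_ennreal) (use d in \<open>simp add: set_integrable_def\<close>)
    also have "\<dots> = (\<integral>\<^sup>+z\<in>Q. ennreal \<bar>u z - u x\<bar> \<partial>lebesgue)"
      by (intro nn_integral_cong) (auto simp: indicator_def)
    finally show ?thesis using Qm by (simp add: ennreal_mult[symmetric] mult.commute)
  qed
  \<comment> \<open>\<open>u\<close> may be non-measurable off \<open>Q\<close>. Replacing it by its
    product with the indicator makes the integrand measurable, so that the constant can be moved
    inside.\<close>
  have "ennreal ?m * (\<integral>\<^sup>+x\<in>Q. ennreal \<bar>u x - mean Q u\<bar> \<partial>lebesgue)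
     = ennreal ?m * (\<integral>\<^sup>+x. ennreal \<bar>indicator Q x *\<^sub>R u x - mean Q u\<bar> * indicator Q x \<partial>lebesgue)"
    by (rule arg_cong[OF nn_integral_cong]) (auto simp: indicator_def)
  also have "\<dots> = (\<integral>\<^sup>+x. ennreal ?m * (ennreal \<bar>indicator Q x *\<^sub>R u x - mean Q u\<bar> * indicator Q x) \<partial>lebesgue)"
    by (intro nn_integral_cmult[symmetric]) measurable
  also have "\<dots> \<le> (\<integral>\<^sup>+x\<in>Q. (\<integral>\<^sup>+z\<in>Q. ennreal \<bar>u z - u x\<bar> \<partial>lebesgue) \<partial>lebesgue)"
    using pw by (intro nn_integral_mono) (auto simp: indicator_def)
  also note osc
  also have "ennreal B * (emeasure lebesgue Q)\<^sup>2 = ennreal ?m * (ennreal B * emeasure lebesgue Q)"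
    by (simp add: eQ power2_eq_square mult_ac)
  finally show ?thesis using Qm by (simp add: ennreal_mult_le_mult_iff)
qed

text \<open>Markov's inequality. It serves at level \<open>2 * B\<close> to start the iteration and,
  when the BMO norm is zero, at every positive level to show that the superlevel sets are
  null.\<close>

lemma markov_deviation_from_mean:
  fixes u :: "real^'n \<Rightarrow> real"
  assumes Q: "is_cube Q" and u: "u \<in> BMO Q" and t: "0 \<le> t"
  shows "t * measure lebesgue {x\<in>Q. t < \<bar>u x - mean Q u\<bar>} \<le> enn2real (bmo_norm Q u) * measure lebesgue Q"
proof -
  let ?E = "{x\<in>Q. t < \<bar>u x - mean Q u\<bar>}" and ?B = "enn2real (bmo_norm Q u)"
  have int: "set_integrable lebesgue Q u" using u by (simp add: BMO_def)
  have Qm: "Q \<in> lmeasurable" using Q by (rule is_cube_lmeasurable)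
  have Es [measurable]: "?E \<in> sets lebesgue" using int Qm by (intro set_integrable_superlevel_sets) auto
  have Em: "?E \<in> lmeasurable" by (rule fmeasurableI2[OF Qm _ Es]) auto
  have "ennreal (t * measure lebesgue ?E) = (\<integral>\<^sup>+x. ennreal t * indicator ?E x \<partial>lebesgue)"
    using t by (simp add: nn_integral_cmult ennreal_mult emeasure_eq_measure2[OF Em])
  also have "\<dots> \<le> (\<integral>\<^sup>+x\<in>Q. ennreal \<bar>u x - mean Q u\<bar> \<partial>lebesgue)"
    by (intro nn_integral_mono) (auto simp: indicator_def intro!: ennreal_leI)
  also have "\<dots> \<le> ennreal ?B * emeasure lebesgue Q"
    using Q u by (intro integral_deviation_from_mean_le int Qm BMO_oscillation is_cube_measure_pos) auto
  also have "\<dots> = ennreal (?B * measure lebesgue Q)"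
    by (simp add: emeasure_eq_measure2[OF Qm] ennreal_mult)
  finally show ?thesis by (simp add: ennreal_le_iff)
qed

section \<open>Iteration of the halving and decay of arbitrary polynomial order\<close>

lemma powr_le_const_mult_power2:
  fixes A r :: real assumes "0 < A"
  obtains c where "0 < c" "\<And>k::nat. (2 + (real k + 1) * A) powr r \<le> c * 2 ^ k"
proof -
  \<comment> \<open>Exponential growth beats every power, so the quotient tends to zero and is in
    particular bounded.\<close>
  have "(\<lambda>k::nat. (2 + (real k + 1) * A) powr r / 2 ^ k) \<longlonglongrightarrow> 0"
    using assms by real_asymp
  then have "Bseq (\<lambda>k::nat. (2 + (real k + 1) * A) powr r / 2 ^ k)"
    by (intro convergent_imp_Bseq convergentI)
  then obtain c where "0 < c" "\<And>k::nat. norm ((2 + (real k + 1) * A) powr r / 2 ^ k) \<le> c"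
    by (auto simp: Bseq_def)
  then show ?thesis by (intro that[of c]) (auto simp: field_simps)
qed

lemma measure_superlevel_antimono:
  assumes "set_integrable lebesgue Q u" "Q \<in> lmeasurable" "s \<le> t"
  shows "measure lebesgue {x\<in>Q. t < \<bar>u x - m\<bar>} \<le> measure lebesgue {x\<in>Q. s < \<bar>u x - m :: real\<bar>}"
  using assms by (intro measure_mono_fmeasurable)
    (auto intro!: set_integrable_superlevel_sets fmeasurableI2[OF assms(2)])

text \<open>Halving needs a level whose superlevel set fills at most half of \<open>Q\<close>; this
  may be \<open>B / 2\<close> or only \<open>2 * B\<close>. With the larger level on the left and
  the smaller on the right, one statement covers both cases.\<close>

lemma superlevel_geometric_decay:
  fixes u :: "real^'n \<Rightarrow> real"
  defines "A \<equiv> 2 ^ (CARD('n) + 4)"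
  assumes Q: "is_cube Q" and u: "u \<in> BMO Q" and B: "B = enn2real (bmo_norm Q u)" "0 < B"
  shows "measure lebesgue {x\<in>Q. 2 * B + real k * (A * B) < \<bar>u x - mean Q u\<bar>}
     \<le> measure lebesgue {x\<in>Q. B / 2 < \<bar>u x - mean Q u\<bar>} / 2 ^ k"
proof -
  define d where "d t = measure lebesgue {x\<in>Q. t < \<bar>u x - mean Q u\<bar>}" for t
  have int: "set_integrable lebesgue Q u" using u by (simp add: BMO_def)
  have Qm: "Q \<in> lmeasurable" using Q by (rule is_cube_lmeasurable)
  have anti: "d t \<le> d s" if "s \<le> t" for s t
    unfolding d_def using measure_superlevel_antimono[OF int Qm that] .
  obtain a0 L where L: "0 < L" "Q = cbox a0 (a0 + (\<chi> i. L))" using Q by (rule is_cubeE)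
  have halving: "d (\<alpha> + A * B) \<le> d \<alpha> / 2" if "d \<alpha> \<le> measure lebesgue Q / 2" for \<alpha>
    unfolding d_def A_def
  proof (rule superlevel_set_halving[OF _ L(2) L(1) B(2)])
    \<comment> \<open>Subtracting the mean leaves all differences unchanged, so the oscillation
      bound for \<open>u\<close> applies.\<close>
    show "(\<integral>\<^sup>+x\<in>cbox a (a + (\<chi> i. l)). (\<integral>\<^sup>+z\<in>cbox a (a + (\<chi> i. l)).
          ennreal \<bar>u z - mean Q u - (u x - mean Q u)\<bar> \<partial>lebesgue) \<partial>lebesgue)
       \<le> ennreal B * (emeasure lebesgue (cbox a (a + (\<chi> i. l))))\<^sup>2"
      if "0 < l" "cbox a (a + (\<chi> i. l)) \<subseteq> Q" for a l
      using BMO_oscillation[OF u is_cube_cbox that(2)] that B by simp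
    show "{x\<in>Q. t < \<bar>u x - mean Q u\<bar>} \<in> sets lebesgue" for t
      using int Qm by (intro set_integrable_superlevel_sets) auto
  qed (use that in \<open>simp add: d_def\<close>)
  have iter: "d (\<alpha> + real k * (A * B)) \<le> d \<alpha> / 2 ^ k" if "d \<alpha> \<le> measure lebesgue Q / 2" for \<alpha>
  proof (induction k)
    case (Suc k)
    have "d (\<alpha> + real k * (A * B)) \<le> measure lebesgue Q / 2"
      using anti[of \<alpha> "\<alpha> + real k * (A * B)"] that B by (simp add: A_def)
    from halving[OF this] Suc show ?case by (simp add: algebra_simps)
  qed simp
  have "d (2 * B + real k * (A * B)) \<le> d (B / 2) / 2 ^ k"
  proof (cases "d (B / 2) \<le> measure lebesgue Q / 2")
    case True
    have "d (2 * B + real k * (A * B)) \<le> d (B / 2 + real k * (A * B))" using B by (intro anti) simp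
    also note iter[OF True]
    finally show ?thesis .
  next
    case False
    have d2: "d (2 * B) \<le> measure lebesgue Q / 2"
      using markov_deviation_from_mean[OF Q u, of "2 * B"] B by (simp add: d_def)
    from iter[OF this] have "d (2 * B + real k * (A * B)) \<le> d (2 * B) / 2 ^ k" .
    \<comment> \<open>Half the volume of \<open>Q\<close> separates the two values:
      \<open>d (2 * B)\<close> is at most that, and \<open>d (B / 2)\<close> exceeds it.\<close>
    also have "\<dots> \<le> d (B / 2) / 2 ^ k" using d2 False by (intro divide_right_mono) auto
    finally show ?thesis .
  qed
  then show ?thesis by (simp add: d_def)
qed

text \<open>Monotonicity extends the geometric decay from the levels
  \<open>2 * B + real k * (A * B)\<close> to all levels. As \<open>2 ^ k\<close> outgrows every
  power of the level, any exponent \<open>r\<close> is reached at the cost of \<open>c\<close>,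
  which is fixed before \<open>Q\<close> and \<open>u\<close>.\<close>

lemma superlevel_polynomial_decay:
  fixes r :: real assumes "0 < r"
  obtains c where "0 < c"
    "\<And>(Q :: (real^'n) set) u \<tau>. is_cube Q \<Longrightarrow> u \<in> BMO Q \<Longrightarrow> 0 < enn2real (bmo_norm Q u) \<Longrightarrow>
      enn2real (bmo_norm Q u) \<le> \<tau> \<Longrightarrow>
      measure lebesgue {x\<in>Q. \<tau> < \<bar>u x - mean Q u\<bar>}
        \<le> c * (enn2real (bmo_norm Q u) / \<tau>) powr r
            * measure lebesgue {x\<in>Q. enn2real (bmo_norm Q u) / 2 < \<bar>u x - mean Q u\<bar>}"
proof -
  define A :: real where "A = 2 ^ (CARD('n) + 4)"
  have "0 < A" by (simp add: A_def)
  then obtain c where c: "0 < c" "\<And>k::nat. (2 + (real k + 1) * A) powr r \<le> c * 2 ^ k"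
    using powr_le_const_mult_power2 by blast
  show ?thesis
  proof (rule that[OF c(1)])
    fix Q :: "(real^'n) set" and u \<tau>
    define B where "B = enn2real (bmo_norm Q u)"
    define d where "d t = measure lebesgue {x\<in>Q. t < \<bar>u x - mean Q u\<bar>}" for t
    assume Q: "is_cube Q" and u: "u \<in> BMO Q" and "0 < enn2real (bmo_norm Q u)" "enn2real (bmo_norm Q u) \<le> \<tau>"
    then have B: "0 < B" "B \<le> \<tau>" by (auto simp: B_def)
    have anti: "d t \<le> d s" if "s \<le> t" for s t
      unfolding d_def using u Q that
      by (intro measure_superlevel_antimono is_cube_lmeasurable) (auto simp: BMO_def)
    \<comment> \<open>The number of full steps from \<open>2 * B\<close> that do not pass
      \<open>\<tau>\<close>. For \<open>\<tau>\<close> below \<open>2 * B\<close> the floor is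
      negative and \<open>nat\<close> turns it into 0, where monotonicity suffices.\<close>
    define k where "k = nat \<lfloor>(\<tau> / B - 2) / A\<rfloor>"
    have "(\<tau> / B - 2) / A \<le> real k + 1" unfolding k_def by linarith
    then have up: "\<tau> / B \<le> 2 + (real k + 1) * A" using \<open>0 < A\<close> by (simp add: pos_divide_le_eq)
    have "d \<tau> \<le> d (B / 2) / 2 ^ k"
    proof (cases "k = 0")
      case True then show ?thesis using B by (simp add: anti)
    next
      case False
      then have "real k \<le> (\<tau> / B - 2) / A" unfolding k_def by linarith
      then have "2 * B + real k * (A * B) \<le> \<tau>" using \<open>0 < A\<close> B by (simp add: field_simps)
      then have "d \<tau> \<le> d (2 * B + real k * (A * B))" by (rule anti)
      also have "\<dots> \<le> d (B / 2) / 2 ^ k"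
        using superlevel_geometric_decay[OF Q u B_def B(1), of k] by (simp add: d_def A_def)
      finally show ?thesis .
    qed
    also have "\<dots> = 1 / 2 ^ k * d (B / 2)" by simp
    also have "\<dots> \<le> c * (B / \<tau>) powr r * d (B / 2)"
    proof (rule mult_right_mono)
      have "(\<tau> / B) powr r \<le> (2 + (real k + 1) * A) powr r"
        using up B assms by (intro powr_mono2) auto
      also note c(2)
      finally have "(\<tau> / B) powr r / 2 ^ k \<le> c" by (simp add: pos_divide_le_eq)
      then have "(\<tau> / B) powr r / 2 ^ k * (B / \<tau>) powr r \<le> c * (B / \<tau>) powr r"
        by (rule mult_right_mono) simp
      moreover have "(\<tau> / B) powr r * (B / \<tau>) powr r = 1"
        using B by (simp add: powr_mult[symmetric])
      ultimately show "1 / 2 ^ k \<le> c * (B / \<tau>) powr r" by simp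
    qed (simp add: d_def)
    finally show "measure lebesgue {x\<in>Q. \<tau> < \<bar>u x - mean Q u\<bar>}
        \<le> c * (enn2real (bmo_norm Q u) / \<tau>) powr r
            * measure lebesgue {x\<in>Q. enn2real (bmo_norm Q u) / 2 < \<bar>u x - mean Q u\<bar>}"
      by (simp add: d_def B_def)
  qed
qed

subsection \<open>Estimates for distribution functions\<close>

lemma epowr_mono: "x \<le> y \<Longrightarrow> 0 \<le> a \<Longrightarrow> epowr x a \<le> epowr y a"
  by (auto simp: epowr_def top_unique less_top enn2real_mono intro!: ennreal_leI powr_mono2)

lemma epowr_ennreal: "0 \<le> x \<Longrightarrow> epowr (ennreal x) a = ennreal (x powr a)"
  by (simp add: epowr_def)

lemma epowr_zero [simp]: "epowr 0 a = 0"
  by (simp add: epowr_def)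

lemma epowr_epowr: "epowr (epowr x a) b = epowr x (a * b)"
  by (simp add: epowr_def powr_powr)

lemma epowr_cmult:
  assumes "0 < c" shows "epowr (ennreal c * x) a = ennreal (c powr a) * epowr x a"
  using assms by (cases x) (auto simp: epowr_def ennreal_mult[symmetric] powr_mult ennreal_mult_top
      ennreal_mult_eq_top_iff ennreal_top_mult)

section \<open>Lorentz norms in terms of a real-valued distribution function\<close>

lemma lorentz_norm_infinity:
  assumes "\<And>t. 0 < t \<Longrightarrow> emeasure lebesgue {x \<in> X. \<bar>f x\<bar> powr q > t} = ennreal (D t)" "\<And>t. 0 \<le> D t"
  shows "lorentz_norm q \<infinity> X f = epowr (SUP t\<in>{0<..}. ennreal (t * D t)) (1 / q)"
proof -
  have "(SUP t \<in> {0::real<..}. ennreal t * emeasure lebesgue {x \<in> X. \<bar>f x\<bar> powr q > t})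
      = (SUP t\<in>{0<..}. ennreal (t * D t))"
    using assms by (intro SUP_cong) (auto simp: ennreal_mult)
  then show ?thesis by (simp add: lorentz_norm_def)
qed

lemma lorentz_norm_finite:
  assumes "\<And>t. 0 < t \<Longrightarrow> emeasure lebesgue {x \<in> X. \<bar>f x\<bar> powr q > t} = ennreal (D t)" "\<And>t. 0 \<le> D t"
    and "\<gamma> \<noteq> \<infinity>" "g = enn2real \<gamma>"
  shows "lorentz_norm q \<gamma> X f =
    epowr (\<integral>\<^sup>+t\<in>{0<..}. ennreal (D t powr (g / q) * t powr (g / q - 1)) \<partial>lborel) (1 / g)"
proof -
  have "(\<integral>\<^sup>+t\<in>{0::real<..}. (epowr (emeasure lebesgue {x \<in> X. \<bar>f x\<bar> powr q > t}) (g / q)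
          * ennreal (t powr (g / q - 1))) \<partial>lborel)
      = (\<integral>\<^sup>+t\<in>{0<..}. ennreal (D t powr (g / q) * t powr (g / q - 1)) \<partial>lborel)"
    using assms(1,2) by (intro nn_integral_cong) (auto simp: indicator_def epowr_ennreal ennreal_mult)
  then show ?thesis using assms(3,4) by (simp add: lorentz_norm_def)
qed

text \<open>Levels are those of the \<open>q\<close>-th power: \<open>b\<close> is the truncation
  level, \<open>G\<close> the distribution function of the truncation, and
  \<open>b * \<theta>\<close> the level of half the BMO norm. Quadratic decay bounds
  \<open>t * D t\<close> beyond \<open>b\<close> by a constant times its value at
  \<open>b * \<theta>\<close>, where \<open>D\<close> and \<open>G\<close> agree.\<close>

lemma SUP_truncation_bound:
  fixes D G :: "real \<Rightarrow> real"
  assumes b: "0 < b" and \<theta>: "0 < \<theta>" "\<theta> < 1" and c: "0 < c"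
    and G: "\<And>t. 0 < t \<Longrightarrow> G t = (if t < b then D t else 0)" and D: "\<And>t. 0 \<le> D t"
    and decay: "\<And>t. b \<le> t \<Longrightarrow> D t \<le> c * (b / t)\<^sup>2 * D (b * \<theta>)"
  shows "(SUP t\<in>{0<..}. ennreal (t * D t)) \<le> ennreal (1 + c / \<theta>) * (SUP t\<in>{0<..}. ennreal (t * G t))"
proof (rule SUP_least)
  let ?M = "SUP t\<in>{0<..}. ennreal (t * G t)"
  fix t :: real assume "t \<in> {0<..}"
  then have t: "0 < t" by simp
  show "ennreal (t * D t) \<le> ennreal (1 + c / \<theta>) * ?M"
  proof (cases "t < b")
    case True
    then have "ennreal (t * D t) \<le> 1 * ?M" using t G by (auto intro!: SUP_upper2[of t])
    also have "\<dots> \<le> ennreal (1 + c / \<theta>) * ?M"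
      using c \<theta> by (intro mult_right_mono) (auto simp flip: ennreal_1 intro!: ennreal_leI)
    finally show ?thesis .
  next
    case False
    then have bt: "b \<le> t" by simp
    have "t * D t \<le> t * (c * (b / t)\<^sup>2 * D (b * \<theta>))" using decay[OF bt] t by (intro mult_left_mono) auto
    also have "\<dots> = c * D (b * \<theta>) * b * (b / t)" using t by (simp add: power2_eq_square field_simps)
    also have "\<dots> \<le> c * D (b * \<theta>) * b * 1" using bt b c D by (intro mult_left_mono) auto
    also have "\<dots> = c / \<theta> * (b * \<theta> * G (b * \<theta>))" using b \<theta> by (simp add: G)
    also have "\<dots> \<le> (1 + c / \<theta>) * (b * \<theta> * G (b * \<theta>))"
      using b \<theta> c D by (intro mult_right_mono) (auto simp: G)
    finally have "ennreal (t * D t) \<le> ennreal (1 + c / \<theta>) * ennreal (b * \<theta> * G (b * \<theta>))"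
      using c \<theta> by (subst ennreal_mult'[symmetric]) (auto intro!: ennreal_leI)
    also have "\<dots> \<le> ennreal (1 + c / \<theta>) * ?M"
      using b \<theta> by (intro mult_left_mono SUP_upper) auto
    finally show ?thesis .
  qed
qed

lemma nn_integral_powr_from_0:
  fixes e c :: real assumes "-1 < e" "0 \<le> c" "0 \<le> k"
  shows "(\<integral>\<^sup>+t. ennreal (k * t powr e) * indicator {0..c} t \<partial>lborel) = ennreal (k * (c powr (e + 1) / (e + 1)))"
  using assms by (intro nn_integral_has_integral_lebesgue' has_integral_mult_right has_integral_powr_from_0) auto

lemma nn_integral_powr_to_inf:
  fixes e a :: real assumes "e < -1" "0 < a" "0 \<le> k"
  shows "(\<integral>\<^sup>+t. ennreal (k * t powr e) * indicator {a..} t \<partial>lborel) = ennreal (k * (- (a powr (e + 1)) / (e + 1)))"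
  using assms by (intro nn_integral_has_integral_lebesgue' has_integral_mult_right has_integral_powr_to_inf) auto

text \<open>Quadratic decay gives the tail beyond \<open>b\<close> the integrable exponent
  \<open>- \<alpha> - 1\<close>. The tail is thus at most a multiple of
  \<open>(b * D (b * \<theta>)) powr \<alpha>\<close>, and so is controlled by the part of the
  integral of \<open>G\<close> below \<open>b * \<theta>\<close>, where \<open>G\<close> is at least
  \<open>D (b * \<theta>)\<close>.\<close>

lemma nn_integral_truncation_bound:
  fixes D G :: "real \<Rightarrow> real"
  assumes b: "0 < b" and \<theta>: "0 < \<theta>" "\<theta> < 1" and c: "0 < c" and \<alpha>: "0 < \<alpha>"
    and G: "\<And>t. 0 < t \<Longrightarrow> G t = (if t < b then D t else 0)" and D: "\<And>t. 0 \<le> D t"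
    and decay: "\<And>t. b \<le> t \<Longrightarrow> D t \<le> c * (b / t)\<^sup>2 * D (b * \<theta>)"
    and anti: "\<And>s t. 0 < s \<Longrightarrow> s \<le> t \<Longrightarrow> D t \<le> D s"
    and [measurable]: "G \<in> borel_measurable borel"
  shows "(\<integral>\<^sup>+t\<in>{0<..}. ennreal (D t powr \<alpha> * t powr (\<alpha> - 1)) \<partial>lborel)
     \<le> ennreal (1 + (c / \<theta>) powr \<alpha>) * (\<integral>\<^sup>+t\<in>{0<..}. ennreal (G t powr \<alpha> * t powr (\<alpha> - 1)) \<partial>lborel)"
    (is "?I \<le> _ * ?J")
proof -
  define D0 where "D0 = D (b * \<theta>)"
  have D0: "0 \<le> D0" by (simp add: D0_def D)
  define k where "k = (c * b\<^sup>2 * D0) powr \<alpha>"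
  have low: "ennreal (D0 powr \<alpha> * ((b * \<theta>) powr \<alpha> / \<alpha>)) \<le> ?J"
  proof -
    have "ennreal (D0 powr \<alpha> * ((b * \<theta>) powr \<alpha> / \<alpha>)) =
        (\<integral>\<^sup>+t. ennreal (D0 powr \<alpha> * t powr (\<alpha> - 1)) * indicator {0..b * \<theta>} t \<partial>lborel)"
      using \<alpha> b \<theta> by (subst nn_integral_powr_from_0) auto
    also have "\<dots> \<le> ?J"
    proof (rule nn_integral_mono)
      fix t :: real
      show "ennreal (D0 powr \<alpha> * t powr (\<alpha> - 1)) * indicator {0..b * \<theta>} t
        \<le> ennreal (G t powr \<alpha> * t powr (\<alpha> - 1)) * indicator {0<..} t"
      proof (cases "0 < t \<and> t \<le> b * \<theta>")
        case True
        moreover have "b * \<theta> < b" using b \<theta> by simp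
        ultimately have "D0 \<le> G t" using anti[of t "b * \<theta>"] by (simp add: G D0_def)
        then have "D0 powr \<alpha> * t powr (\<alpha> - 1) \<le> G t powr \<alpha> * t powr (\<alpha> - 1)"
          using \<alpha> D0 by (intro mult_right_mono powr_mono2) auto
        then show ?thesis using True by (simp add: ennreal_leI)
      next
        \<comment> \<open>At \<open>t = 0\<close> the power is 0 by convention, so the closed
          interval on the left adds nothing.\<close>
        case False then show ?thesis by (cases "t = 0") (auto simp: indicator_def)
      qed
    qed
    finally show ?thesis .
  qed
  have "?I \<le> (\<integral>\<^sup>+t. ennreal (G t powr \<alpha> * t powr (\<alpha> - 1)) * indicator {0<..} t
        + ennreal (k * t powr (- \<alpha> - 1)) * indicator {b..} t \<partial>lborel)"
  proof (rule nn_integral_mono)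
    fix t :: real
    show "ennreal (D t powr \<alpha> * t powr (\<alpha> - 1)) * indicator {0<..} t
      \<le> ennreal (G t powr \<alpha> * t powr (\<alpha> - 1)) * indicator {0<..} t
        + ennreal (k * t powr (- \<alpha> - 1)) * indicator {b..} t"
    proof (cases "b \<le> t")
      case True
      then have t: "0 < t" using b by simp
      have "D t powr \<alpha> \<le> (c * (b / t)\<^sup>2 * D (b * \<theta>)) powr \<alpha>"
        using decay[OF True] D \<alpha> by (intro powr_mono2) auto
      also have "c * (b / t)\<^sup>2 * D (b * \<theta>) = c * b\<^sup>2 * D0 * t powr (-2)"
        using t by (simp add: D0_def powr_minus powr_numeral power_divide field_simps)
      also have "(\<dots>) powr \<alpha> = k * t powr (- 2 * \<alpha>)"
        using c b D0 t by (simp add: k_def powr_mult powr_powr)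
      finally have "D t powr \<alpha> * t powr (\<alpha> - 1) \<le> k * t powr (- 2 * \<alpha>) * t powr (\<alpha> - 1)"
        by (rule mult_right_mono) simp
      also have "\<dots> = k * t powr (- \<alpha> - 1)" by (simp add: mult.assoc powr_add[symmetric])
      finally show ?thesis using True t by (auto simp: ennreal_leI add_increasing)
    qed (auto simp: indicator_def G)
  qed
  also have "\<dots> = ?J + (\<integral>\<^sup>+t. ennreal (k * t powr (- \<alpha> - 1)) * indicator {b..} t \<partial>lborel)"
    by (rule nn_integral_add) measurable
  also have "(\<integral>\<^sup>+t. ennreal (k * t powr (- \<alpha> - 1)) * indicator {b..} t \<partial>lborel) = ennreal (k * (b powr (- \<alpha>) / \<alpha>))"
    using \<alpha> b by (subst nn_integral_powr_to_inf) (auto simp: k_def)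
  \<comment> \<open>Rewritten to expose the left side of \<open>low\<close>; passing from
    \<open>b\<close> to \<open>b * \<theta>\<close> puts \<open>\<theta>\<close> into the
    denominator.\<close>
  also have "k * (b powr (- \<alpha>) / \<alpha>) = (c / \<theta>) powr \<alpha> * (D0 powr \<alpha> * ((b * \<theta>) powr \<alpha> / \<alpha>))"
  proof -
    have "(b\<^sup>2) powr \<alpha> = b powr \<alpha> * b powr \<alpha>" using b by (simp add: power2_eq_square powr_mult)
    then have "k = c powr \<alpha> * (b powr \<alpha> * b powr \<alpha>) * D0 powr \<alpha>"
      unfolding k_def using b c D0 by (simp add: powr_mult)
    moreover have "b powr (-\<alpha>) = 1 / b powr \<alpha>" by (simp add: powr_minus_divide)
    moreover have "(c / \<theta>) powr \<alpha> = c powr \<alpha> / \<theta> powr \<alpha>" using c \<theta> by (simp add: powr_divide)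
    moreover have "(b * \<theta>) powr \<alpha> = b powr \<alpha> * \<theta> powr \<alpha>" using b \<theta> by (simp add: powr_mult)
    moreover have "b powr \<alpha> \<noteq> 0" "\<theta> powr \<alpha> \<noteq> 0" using b \<theta> by auto
    ultimately show ?thesis by simp
  qed
  also have "ennreal \<dots> = ennreal ((c / \<theta>) powr \<alpha>) * ennreal (D0 powr \<alpha> * ((b * \<theta>) powr \<alpha> / \<alpha>))"
    by (rule ennreal_mult') simp
  also have "?J + \<dots> \<le> ?J + ennreal ((c / \<theta>) powr \<alpha>) * ?J"
    using low by (intro add_left_mono mult_left_mono) auto
  also have "\<dots> = ennreal (1 + (c / \<theta>) powr \<alpha>) * ?J"
    by (simp add: ennreal_plus distrib_right)
  finally show ?thesis .
qed

text \<open>As \<open>\<beta> < 1\<close>, the function \<open>t * t powr (- \<beta>)\<close>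
  increases, so its value at \<open>b\<close> bounds all others.\<close>

lemma SUP_weak_type_bound:
  fixes G :: "real \<Rightarrow> real"
  assumes \<beta>: "0 < \<beta>" "\<beta> < 1" and b: "0 < b" and k: "0 \<le> k"
    and G: "\<And>t. 0 < t \<Longrightarrow> t < b \<Longrightarrow> G t \<le> k * t powr (- \<beta>)" "\<And>t. b \<le> t \<Longrightarrow> G t = 0"
  shows "(SUP t\<in>{0<..}. ennreal (t * G t)) \<le> ennreal (k * b powr (1 - \<beta>))"
proof (intro SUP_least ennreal_leI)
  fix t :: real assume "t \<in> {0<..}"
  then have t: "0 < t" by simp
  show "t * G t \<le> k * b powr (1 - \<beta>)"
  proof (cases "t < b")
    case True
    have "t * G t \<le> t * (k * t powr (- \<beta>))" using G(1)[OF t True] t by (intro mult_left_mono) auto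
    also have "\<dots> = k * t powr (1 - \<beta>)" using t by (simp add: powr_diff powr_minus_divide)
    also have "\<dots> \<le> k * b powr (1 - \<beta>)" using k t True \<beta> by (intro mult_left_mono powr_mono2) auto
    finally show ?thesis .
  qed (use G k in auto)
qed

text \<open>As \<open>\<beta> < 1\<close>, the exponent \<open>\<alpha> * (1 - \<beta>) - 1\<close>
  exceeds -1, so the weak-type bound is integrable at 0; the cut at \<open>b\<close> removes the
  divergence at infinity.\<close>

lemma nn_integral_weak_type_bound:
  fixes G :: "real \<Rightarrow> real"
  assumes \<beta>: "0 < \<beta>" "\<beta> < 1" and b: "0 < b" and k: "0 \<le> k" and \<alpha>: "0 < \<alpha>"
    and G: "\<And>t. 0 < t \<Longrightarrow> t < b \<Longrightarrow> G t \<le> k * t powr (- \<beta>)" "\<And>t. b \<le> t \<Longrightarrow> G t = 0" "\<And>t. 0 \<le> G t"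
  shows "(\<integral>\<^sup>+t\<in>{0<..}. ennreal (G t powr \<alpha> * t powr (\<alpha> - 1)) \<partial>lborel)
    \<le> ennreal ((k * b powr (1 - \<beta>)) powr \<alpha> / (\<alpha> * (1 - \<beta>)))"
proof -
  have "(\<integral>\<^sup>+t\<in>{0<..}. ennreal (G t powr \<alpha> * t powr (\<alpha> - 1)) \<partial>lborel)
     \<le> (\<integral>\<^sup>+t. ennreal (k powr \<alpha> * t powr (\<alpha> * (1 - \<beta>) - 1)) * indicator {0..b} t \<partial>lborel)"
  proof (rule nn_integral_mono)
    fix t :: real
    show "ennreal (G t powr \<alpha> * t powr (\<alpha> - 1)) * indicator {0<..} t
       \<le> ennreal (k powr \<alpha> * t powr (\<alpha> * (1 - \<beta>) - 1)) * indicator {0..b} t"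
    proof (cases "0 < t \<and> t < b")
      case True
      have "G t powr \<alpha> * t powr (\<alpha> - 1) \<le> (k * t powr (- \<beta>)) powr \<alpha> * t powr (\<alpha> - 1)"
        using G True \<alpha> by (intro mult_right_mono powr_mono2) auto
      also have "\<dots> = k powr \<alpha> * (t powr (- \<beta> * \<alpha>) * t powr (\<alpha> - 1))"
        using k True by (simp add: powr_mult powr_powr)
      also have "\<dots> = k powr \<alpha> * t powr (\<alpha> * (1 - \<beta>) - 1)"
        by (simp add: powr_add[symmetric] algebra_simps)
      finally show ?thesis using True by (simp add: ennreal_leI)
    qed (use G in \<open>auto simp: indicator_def\<close>)
  qed
  also have "\<dots> = ennreal (k powr \<alpha> * (b powr (\<alpha> * (1 - \<beta>)) / (\<alpha> * (1 - \<beta>))))"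
    using \<alpha> \<beta> b by (subst nn_integral_powr_from_0) auto
  also have "k powr \<alpha> * (b powr (\<alpha> * (1 - \<beta>)) / (\<alpha> * (1 - \<beta>))) = (k * b powr (1 - \<beta>)) powr \<alpha> / (\<alpha> * (1 - \<beta>))"
    using k b by (simp add: powr_mult powr_powr mult.commute)
  finally show ?thesis .
qed

subsection \<open>Lorentz norms of BMO functions\<close>

lemma less_powr_iff_root_less:
  fixes t y q :: real
  assumes "0 < q" "0 < t" "0 \<le> y"
  shows "t < y powr q \<longleftrightarrow> t powr (1 / q) < y"
proof -
  have "t = (t powr (1 / q)) powr q" using assms by (simp add: powr_powr)
  moreover have "(t powr (1 / q)) powr q < y powr q \<longleftrightarrow> t powr (1 / q) < y"
    using assms by (metis linorder_not_less powr_ge_zero powr_less_mono2 powr_mono2 less_imp_le)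
  ultimately show ?thesis by metis
qed

lemma emeasure_superlevel_powr:
  fixes u :: "real^'n \<Rightarrow> real"
  assumes "set_integrable lebesgue Q u" "Q \<in> lmeasurable" "0 < q" "0 < t"
  shows "emeasure lebesgue {x\<in>Q. t < \<bar>u x - m\<bar> powr q}
     = ennreal (measure lebesgue {x\<in>Q. t powr (1 / q) < \<bar>u x - m\<bar>})"
proof -
  have "{x\<in>Q. t < \<bar>u x - m\<bar> powr q} = {x\<in>Q. t powr (1 / q) < \<bar>u x - m\<bar>}"
    using assms by (auto simp: less_powr_iff_root_less)
  moreover have "{x\<in>Q. t powr (1 / q) < \<bar>u x - m\<bar>} \<in> lmeasurable"
    using assms by (intro fmeasurableI2[OF assms(2)] set_integrable_superlevel_sets) auto
  ultimately show ?thesis by (simp only: emeasure_eq_measure2)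
qed

text \<open>A minimum exceeds a level exactly when both entries do, so truncation at
  \<open>B\<close> merely switches the distribution function off from level \<open>B powr q\<close>
  on.\<close>

lemma emeasure_superlevel_powr_min:
  fixes u :: "real^'n \<Rightarrow> real"
  assumes "set_integrable lebesgue Q u" "Q \<in> lmeasurable" "0 < q" "0 < t" "0 \<le> B"
  shows "emeasure lebesgue {x\<in>Q. t < \<bar>min \<bar>u x - m\<bar> B\<bar> powr q}
     = ennreal (if t < B powr q then measure lebesgue {x\<in>Q. t powr (1 / q) < \<bar>u x - m\<bar>} else 0)"
proof (cases "t < B powr q")
  case True
  then have "t powr (1 / q) < B" using assms by (simp add: less_powr_iff_root_less)
  then have eq: "{x\<in>Q. t < \<bar>min \<bar>u x - m\<bar> B\<bar> powr q} = {x\<in>Q. t < \<bar>u x - m\<bar> powr q}"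
    using assms by (auto simp: less_powr_iff_root_less)
  show ?thesis by (simp only: eq emeasure_superlevel_powr[OF assms(1-4)] True if_True)
next
  case False
  then have tB: "\<not> t powr (1 / q) < B" by (simp only: less_powr_iff_root_less[OF assms(3-5)] not_False_eq_True)
  have "\<not> t < \<bar>min \<bar>u x - m\<bar> B\<bar> powr q" for x
  proof -
    have "\<bar>min \<bar>u x - m\<bar> B\<bar> \<le> B" using assms(5) by simp
    then have "\<not> t powr (1 / q) < \<bar>min \<bar>u x - m\<bar> B\<bar>" using tB by linarith
    then show ?thesis by (simp only: less_powr_iff_root_less[OF assms(3,4) abs_ge_zero] not_False_eq_True)
  qed
  then have "{x\<in>Q. t < \<bar>min \<bar>u x - m\<bar> B\<bar> powr q} = {}" by blast
  then have "emeasure lebesgue {x\<in>Q. t < \<bar>min \<bar>u x - m\<bar> B\<bar> powr q} = 0" by (simp only: emeasure_empty)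
  then show ?thesis by (simp only: False if_False ennreal_0)
qed

text \<open>Serves the degenerate case of a vanishing BMO norm, for finite and infinite
  \<open>\<gamma>\<close> alike.\<close>

lemma lorentz_norm_eq_0:
  assumes "\<And>t. 0 < t \<Longrightarrow> emeasure lebesgue {x \<in> X. \<bar>f x\<bar> powr q > t} = 0"
  shows "lorentz_norm q \<gamma> X f = 0"
proof (cases "\<gamma> = \<infinity>")
  case True
  have "(SUP t\<in>{0<..}. ennreal (t * 0)) = 0" by simp
  moreover have "lorentz_norm q \<infinity> X f = epowr (SUP t\<in>{0<..}. ennreal (t * 0)) (1 / q)"
    by (rule lorentz_norm_infinity) (simp_all only: assms ennreal_0 order_refl)
  ultimately show ?thesis using True by (simp only: epowr_zero)
next
  case False
  have "lorentz_norm q \<gamma> X f = epowr (\<integral>\<^sup>+t\<in>{0<..}. ennreal (0 powr (enn2real \<gamma> / q) * t powr (enn2real \<gamma> / q - 1)) \<partial>lborel) (1 / enn2real \<gamma>)"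
    by (rule lorentz_norm_finite[OF _ _ False refl]) (simp_all only: assms ennreal_0 order_refl)
  then show ?thesis by simp
qed

text \<open>Under the substitution \<open>t = \<tau> powr q\<close>, decay of order
  \<open>2 * q\<close> in \<open>\<tau>\<close> becomes the quadratic decay in \<open>t\<close> that
  both truncation bounds require.\<close>

lemma lorentz_norm_le_truncation:
  assumes q: "0 < q" and \<gamma>: "0 < \<gamma>"
  obtains C where "0 < C"
    "\<And>(Q :: (real^'n) set) u. is_cube Q \<Longrightarrow> u \<in> BMO Q \<Longrightarrow>
       lorentz_norm q \<gamma> Q (\<lambda>x. u x - mean Q u)
         \<le> ennreal C * lorentz_norm q \<gamma> Q (\<lambda>x. min \<bar>u x - mean Q u\<bar> (enn2real (bmo_norm Q u)))"
proof -
  obtain c where c: "0 < c"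
    "\<And>(Q :: (real^'n) set) u \<tau>. is_cube Q \<Longrightarrow> u \<in> BMO Q \<Longrightarrow> 0 < enn2real (bmo_norm Q u) \<Longrightarrow>
      enn2real (bmo_norm Q u) \<le> \<tau> \<Longrightarrow>
      measure lebesgue {x\<in>Q. \<tau> < \<bar>u x - mean Q u\<bar>}
        \<le> c * (enn2real (bmo_norm Q u) / \<tau>) powr (2 * q)
            * measure lebesgue {x\<in>Q. enn2real (bmo_norm Q u) / 2 < \<bar>u x - mean Q u\<bar>}"
    by (rule superlevel_polynomial_decay[of "2 * q"]) (use q in \<open>simp, blast\<close>)
  define g where "g = enn2real \<gamma>"
  \<comment> \<open>Chosen so that the \<open>q\<close>-th root of \<open>b * \<theta>\<close> is
    \<open>B / 2\<close>, the level on the right of the decay estimate.\<close>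
  define \<theta> :: real where "\<theta> = 2 powr (- q)"
  have \<theta>: "0 < \<theta>" "\<theta> < 1" using q powr_less_mono[of "-q" 0 2] by (auto simp: \<theta>_def)
  define C where "C = (if \<gamma> = \<infinity> then (1 + c / \<theta>) powr (1 / q) else (1 + (c / \<theta>) powr (g / q)) powr (1 / g))"
  have pos: "0 < 1 + c / \<theta>" "0 < 1 + (c / \<theta>) powr (g / q)" using c(1) \<theta> by (auto intro!: add_pos_nonneg)
  have C: "0 < C" using pos by (auto simp: C_def)
  have main: "lorentz_norm q \<gamma> Q (\<lambda>x. u x - mean Q u)
         \<le> ennreal C * lorentz_norm q \<gamma> Q (\<lambda>x. min \<bar>u x - mean Q u\<bar> (enn2real (bmo_norm Q u)))"
    if Q: "is_cube Q" and u: "u \<in> BMO Q" for Q :: "(real^'n) set" and u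
  proof -
    define B where "B = enn2real (bmo_norm Q u)"
    define d where "d t = measure lebesgue {x\<in>Q. t < \<bar>u x - mean Q u\<bar>}" for t
    define b where "b = B powr q"
    define D where "D t = d (t powr (1 / q))" for t
    define G where "G t = (if t < b then D t else 0)" for t
    have int: "set_integrable lebesgue Q u" using u by (simp add: BMO_def)
    have Qm: "Q \<in> lmeasurable" using Q by (rule is_cube_lmeasurable)
    have B0: "0 \<le> B" by (simp add: B_def)
    have Df: "emeasure lebesgue {x\<in>Q. t < \<bar>u x - mean Q u\<bar> powr q} = ennreal (D t)" if "0 < t" for t
      unfolding D_def d_def by (rule emeasure_superlevel_powr[OF int Qm q that])
    have Dg: "emeasure lebesgue {x\<in>Q. t < \<bar>min \<bar>u x - mean Q u\<bar> B\<bar> powr q} = ennreal (G t)" if "0 < t" for t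
      unfolding G_def D_def d_def b_def by (rule emeasure_superlevel_powr_min[OF int Qm q that B0])
    have D0: "0 \<le> D t" for t unfolding D_def d_def by (rule measure_nonneg)
    have G0: "0 \<le> G t" for t unfolding G_def using D0 by simp
    have anti: "d t \<le> d s" if "s \<le> t" for s t
      unfolding d_def using measure_superlevel_antimono[OF int Qm that] .
    show ?thesis
    proof (cases "B = 0")
      case True
      have "D t = 0" if "0 < t" for t
      proof -
        have "t powr (1 / q) * D t \<le> 0"
          using markov_deviation_from_mean[OF Q u, of "t powr (1 / q)", folded d_def D_def B_def] True by simp
        moreover have "0 < t powr (1 / q)" using that by simp
        ultimately show ?thesis using D0[of t] by (simp add: mult_le_0_iff)
      qed
      then have "lorentz_norm q \<gamma> Q (\<lambda>x. u x - mean Q u) = 0"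
        by (intro lorentz_norm_eq_0) (simp only: Df ennreal_0)
      then show ?thesis by (simp only: zero_le)
    next
      case False
      then have B: "0 < B" using B0 by simp
      then have b: "0 < b" by (simp add: b_def)
      have decay: "D t \<le> c * (b / t)\<^sup>2 * D (b * \<theta>)" if t: "b \<le> t" for t
      proof -
        have t0: "0 < t" using b t by simp
        have "\<not> t powr (1 / q) < B"
          using t less_powr_iff_root_less[OF q t0, of B] B by (simp add: b_def)
        then have "D t \<le> c * (B / t powr (1 / q)) powr (2 * q) * d (B / 2)"
          using c(2)[OF Q u, of "t powr (1 / q)", folded d_def D_def B_def] B by simp
        moreover have "(B / t powr (1 / q)) powr (2 * q) = (b / t)\<^sup>2"
        proof -
          have "(B / t powr (1 / q)) powr q = b / t"
            using q B t0 by (simp add: powr_divide powr_powr b_def)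
          then have "(B / t powr (1 / q)) powr (q + q) = (b / t) * (b / t)" by (simp only: powr_add)
          then show ?thesis by (simp add: power2_eq_square)
        qed
        moreover have "(b * \<theta>) powr (1 / q) = B / 2"
          using q B by (simp add: b_def \<theta>_def powr_mult powr_powr powr_neg_one)
        ultimately show ?thesis unfolding D_def by (simp only:)
      qed
      have antiD: "D t \<le> D s" if "0 < s" "s \<le> t" for s t
        unfolding D_def using that q by (intro anti powr_mono2) auto
      \<comment> \<open>\<open>d\<close> is antitone, so its Borel measurability comes from that of
        the monotone function \<open>- d\<close>.\<close>
      have "mono (\<lambda>t. - d t)" using anti by (auto simp: mono_def)
      then have "(\<lambda>t. - (- d t)) \<in> borel_measurable borel"
        by (intro borel_measurable_uminus borel_measurable_mono)
      then have [measurable]: "d \<in> borel_measurable borel" by simp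
      have Gm: "G \<in> borel_measurable borel" unfolding G_def D_def by measurable
      show ?thesis
      proof (cases "\<gamma> = \<infinity>")
        case True
        have "epowr (SUP t\<in>{0<..}. ennreal (t * D t)) (1 / q)
            \<le> epowr (ennreal (1 + c / \<theta>) * (SUP t\<in>{0<..}. ennreal (t * G t))) (1 / q)"
          using b \<theta> c(1) D0 decay q by (intro epowr_mono SUP_truncation_bound) (auto simp: G_def)
        also have "\<dots> = ennreal C * epowr (SUP t\<in>{0<..}. ennreal (t * G t)) (1 / q)"
          unfolding epowr_cmult[OF pos(1)] by (simp only: C_def True simp_thms if_True)
        also have "epowr (SUP t\<in>{0<..}. ennreal (t * G t)) (1 / q) =
            lorentz_norm q \<infinity> Q (\<lambda>x. min \<bar>u x - mean Q u\<bar> B)"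
          by (rule lorentz_norm_infinity[OF Dg G0, symmetric])
        also have "epowr (SUP t\<in>{0<..}. ennreal (t * D t)) (1 / q) = lorentz_norm q \<infinity> Q (\<lambda>x. u x - mean Q u)"
          by (rule lorentz_norm_infinity[OF Df D0, symmetric])
        finally show ?thesis unfolding B_def[symmetric] True .
      next
        case False
        then have g: "0 < g" using \<gamma> by (simp add: g_def enn2real_positive_iff less_top)
        have "epowr (\<integral>\<^sup>+t\<in>{0<..}. ennreal (D t powr (g / q) * t powr (g / q - 1)) \<partial>lborel) (1 / g)
          \<le> epowr (ennreal (1 + (c / \<theta>) powr (g / q)) *
               (\<integral>\<^sup>+t\<in>{0<..}. ennreal (G t powr (g / q) * t powr (g / q - 1)) \<partial>lborel)) (1 / g)"
          using q g by (intro epowr_mono nn_integral_truncation_bound[OF b \<theta> c(1) _ _ D0 decay antiD Gm]) (auto simp: G_def)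
        also have "\<dots> = ennreal C * epowr (\<integral>\<^sup>+t\<in>{0<..}. ennreal (G t powr (g / q) * t powr (g / q - 1)) \<partial>lborel) (1 / g)"
          unfolding epowr_cmult[OF pos(2)] by (simp only: C_def False if_False)
        also have "epowr (\<integral>\<^sup>+t\<in>{0<..}. ennreal (G t powr (g / q) * t powr (g / q - 1)) \<partial>lborel) (1 / g) =
            lorentz_norm q \<gamma> Q (\<lambda>x. min \<bar>u x - mean Q u\<bar> B)"
          by (rule lorentz_norm_finite[OF Dg G0 False g_def, symmetric])
        also have "epowr (\<integral>\<^sup>+t\<in>{0<..}. ennreal (D t powr (g / q) * t powr (g / q - 1)) \<partial>lborel) (1 / g) =
            lorentz_norm q \<gamma> Q (\<lambda>x. u x - mean Q u)"
          by (rule lorentz_norm_finite[OF Df D0 False g_def, symmetric])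
        finally show ?thesis unfolding B_def[symmetric] .
      qed
    qed
  qed
  show ?thesis by (rule that[OF C main])
qed

text \<open>With \<open>s = t powr (p / q)\<close>, the sets in the supremum are the superlevel sets
  of the \<open>q\<close>-th power at level \<open>t\<close>. The supremum thus yields a weak-type
  bound of order \<open>p / q < 1\<close> on the distribution function below the truncation
  level.\<close>

lemma lorentz_norm_truncation_le_weak:
  assumes pq: "0 < p" "p < q" and \<gamma>: "0 < \<gamma>"
  obtains C where "0 < C"
    "\<And>(Q :: (real^'n) set) u. is_cube Q \<Longrightarrow> u \<in> BMO Q \<Longrightarrow>
       lorentz_norm q \<gamma> Q (\<lambda>x. min \<bar>u x - mean Q u\<bar> (enn2real (bmo_norm Q u)))
         \<le> ennreal C
             * (SUP s \<in> {s :: real. 0 < s \<and> ennreal s \<le> epowr (bmo_norm Q u) p}.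
                  epowr (ennreal s * emeasure lebesgue {x \<in> Q. \<bar>u x - mean Q u\<bar> powr p > s}) (1 / q))
             * epowr (bmo_norm Q u) (1 - p / q)"
proof -
  define g where "g = enn2real \<gamma>"
  define \<beta> where "\<beta> = p / q"
  have q: "0 < q" using pq by simp
  have \<beta>: "0 < \<beta>" "\<beta> < 1" using pq by (auto simp: \<beta>_def)
  \<comment> \<open>For finite \<open>\<gamma>\<close>, the \<open>g\<close>-th root of the factor
    from \<open>nn_integral_weak_type_bound\<close> with \<open>\<alpha> = g / q\<close>.\<close>
  define C where "C = (if \<gamma> = \<infinity> then 1 else (1 / (g / q * (1 - \<beta>))) powr (1 / g))"
  have g: "0 < g" if "\<gamma> \<noteq> \<infinity>" using \<gamma> that by (simp add: g_def enn2real_positive_iff less_top)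
  have C: "0 < C" using g \<beta> q by (auto simp: C_def)
  have main: "lorentz_norm q \<gamma> Q (\<lambda>x. min \<bar>u x - mean Q u\<bar> (enn2real (bmo_norm Q u)))
         \<le> ennreal C
             * (SUP s \<in> {s :: real. 0 < s \<and> ennreal s \<le> epowr (bmo_norm Q u) p}.
                  epowr (ennreal s * emeasure lebesgue {x \<in> Q. \<bar>u x - mean Q u\<bar> powr p > s}) (1 / q))
             * epowr (bmo_norm Q u) (1 - p / q)"
    (is "?L \<le> ennreal C * ?S * _")
    if Q: "is_cube Q" and u: "u \<in> BMO Q" for Q :: "(real^'n) set" and u
  proof -
    define B where "B = enn2real (bmo_norm Q u)"
    define b where "b = B powr q"
    define D where "D t = measure lebesgue {x\<in>Q. t powr (1 / q) < \<bar>u x - mean Q u\<bar>}" for t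
    define G where "G t = (if t < b then D t else 0)" for t
    have int: "set_integrable lebesgue Q u" using u by (simp add: BMO_def)
    have Qm: "Q \<in> lmeasurable" using Q by (rule is_cube_lmeasurable)
    have B0: "0 \<le> B" by (simp add: B_def)
    have bmo: "bmo_norm Q u = ennreal B" using u by (simp add: BMO_def B_def)
    have D0: "0 \<le> D t" for t unfolding D_def by (rule measure_nonneg)
    have G0: "0 \<le> G t" for t unfolding G_def using D0 by simp
    have Dg: "emeasure lebesgue {x\<in>Q. t < \<bar>min \<bar>u x - mean Q u\<bar> B\<bar> powr q} = ennreal (G t)" if "0 < t" for t
      unfolding G_def D_def b_def by (rule emeasure_superlevel_powr_min[OF int Qm q that B0])
    define S where "S = ?S"
    show ?thesis
    proof (cases "B = 0")
      case True
      \<comment> \<open>The truncation at 0 vanishes, so the left side is 0, whatever the convention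
        for the empty supremum on the right.\<close>
      then have "G t = 0" if "0 < t" for t using that by (simp add: G_def b_def)
      then have "?L = 0" unfolding B_def[symmetric] by (intro lorentz_norm_eq_0) (simp only: Dg ennreal_0)
      then show ?thesis by (simp only: zero_le)
    next
      case False
      then have B: "0 < B" using B0 by simp
      then have b: "0 < b" by (simp add: b_def)
      have eB: "epowr (bmo_norm Q u) (1 - p / q) = ennreal (B powr (1 - \<beta>))"
        using B by (simp add: bmo epowr_ennreal \<beta>_def)
      show ?thesis
      proof (cases "S = \<infinity>")
        case True
        \<comment> \<open>\<open>B\<close> and \<open>C\<close> are positive, so an infinite
          supremum makes the right side infinite and the claim trivial.\<close>
        have "ennreal C * S * epowr (bmo_norm Q u) (1 - p / q) = \<infinity>"
          unfolding True eB using B C by (simp add: ennreal_mult_top ennreal_top_mult)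
        then show ?thesis unfolding S_def[symmetric] by (simp only: infinity_ennreal_def top_greatest)
      next
        case False
        define \<sigma> where "\<sigma> = enn2real S"
        have S: "S = ennreal \<sigma>" using False by (simp add: \<sigma>_def less_top)
        have \<sigma>: "0 \<le> \<sigma>" by (simp add: \<sigma>_def)
        have G1: "G t \<le> \<sigma> powr q * t powr (- \<beta>)" if t: "0 < t" "t < b" for t
        proof -
          \<comment> \<open>The level for the \<open>p\<close>-th power that corresponds to
            \<open>t\<close>; the condition \<open>t < b\<close> places it in the range of the
            supremum.\<close>
          define s where "s = t powr \<beta>"
          have s: "0 < s" using t by (simp add: s_def)
          have "s \<le> b powr \<beta>" unfolding s_def using t \<beta> by (intro powr_mono2) auto
          also have "\<dots> = B powr p" using q by (simp add: b_def powr_powr \<beta>_def)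
          finally have sB: "ennreal s \<le> epowr (bmo_norm Q u) p"
            using B by (simp add: bmo epowr_ennreal ennreal_leI)
          have "s powr (1 / p) = t powr (1 / q)" using pq by (simp add: s_def powr_powr \<beta>_def)
          then have "emeasure lebesgue {x \<in> Q. \<bar>u x - mean Q u\<bar> powr p > s} = ennreal (D t)"
            unfolding D_def using emeasure_superlevel_powr[OF int Qm pq(1) s, of "mean Q u"] by (simp only:)
          then have "ennreal ((s * D t) powr (1 / q)) =
              epowr (ennreal s * emeasure lebesgue {x \<in> Q. \<bar>u x - mean Q u\<bar> powr p > s}) (1 / q)"
            using s D0[of t] by (simp only: ennreal_mult''[symmetric] epowr_ennreal mult_nonneg_nonneg less_imp_le)
          also have "\<dots> \<le> S" unfolding S_def using s sB by (intro SUP_upper) auto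
          finally have "(s * D t) powr (1 / q) \<le> \<sigma>" using \<sigma> by (simp only: S ennreal_le_iff)
          then have "((s * D t) powr (1 / q)) powr q \<le> \<sigma> powr q" using q by (intro powr_mono2) auto
          then have "s * D t \<le> \<sigma> powr q" using q s by (simp add: powr_powr D0)
          then show ?thesis using s t by (simp add: G_def s_def powr_minus field_simps)
        qed
        have G2: "G t = 0" if "b \<le> t" for t using that by (simp add: G_def)
        have root: "(\<sigma> powr q * b powr (1 - \<beta>)) powr (1 / q) = \<sigma> * B powr (1 - \<beta>)"
          using \<sigma> q B by (simp add: powr_mult powr_powr b_def)
        have "?L \<le> ennreal (C * (\<sigma> * B powr (1 - \<beta>)))"
        proof (cases "\<gamma> = \<infinity>")
          case True
          have "?L = epowr (SUP t\<in>{0<..}. ennreal (t * G t)) (1 / q)"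
            unfolding B_def[symmetric] True by (rule lorentz_norm_infinity[OF Dg G0])
          also have "\<dots> \<le> epowr (ennreal (\<sigma> powr q * b powr (1 - \<beta>))) (1 / q)"
            using \<beta> b G1 G2 q by (intro epowr_mono SUP_weak_type_bound) auto
          also have "\<dots> = ennreal (\<sigma> * B powr (1 - \<beta>))" by (simp add: epowr_ennreal root)
          finally show ?thesis using True by (simp add: C_def)
        next
          case False
          note g = g[OF False]
          let ?k = "\<sigma> powr q * b powr (1 - \<beta>)"
          have "?L = epowr (\<integral>\<^sup>+t\<in>{0<..}. ennreal (G t powr (g / q) * t powr (g / q - 1)) \<partial>lborel) (1 / g)"
            unfolding B_def[symmetric] by (rule lorentz_norm_finite[OF Dg G0 False g_def])
          also have "\<dots> \<le> epowr (ennreal (?k powr (g / q) / (g / q * (1 - \<beta>)))) (1 / g)"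
            using \<beta> b G0 G1 G2 q g by (intro epowr_mono nn_integral_weak_type_bound) auto
          also have "\<dots> = ennreal ((?k powr (g / q) * (1 / (g / q * (1 - \<beta>)))) powr (1 / g))"
            using \<beta> q g by (simp add: epowr_ennreal)
          also have "(?k powr (g / q) * (1 / (g / q * (1 - \<beta>)))) powr (1 / g)
             = (?k powr (g / q)) powr (1 / g) * (1 / (g / q * (1 - \<beta>))) powr (1 / g)"
            using \<beta> q g by (intro powr_mult)
          also have "(?k powr (g / q)) powr (1 / g) = \<sigma> * B powr (1 - \<beta>)"
            using g root by (simp add: powr_powr)
          finally show ?thesis using False by (simp add: C_def mult.commute)
        qed
        then show ?thesis unfolding S_def[symmetric] S eB using C \<sigma> by (simp add: ennreal_mult mult.assoc)
      qed
    qed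
  qed
  show ?thesis by (rule that[OF C main])
qed

text \<open>Dropping the restriction \<open>P\<close> only enlarges the supremum, and the outer root
  \<open>1 / p\<close> of the weak norm combines with \<open>p / q\<close> to
  \<open>1 / q\<close>.\<close>

lemma SUP_epowr_le_weak_Lp_norm:
  assumes "0 < p" "0 < q"
  shows "(SUP s \<in> {s :: real. 0 < s \<and> P s}. epowr (ennreal s * emeasure lebesgue {x \<in> X. \<bar>f x\<bar> powr p > s}) (1 / q))
    \<le> epowr (weak_Lp_norm p X f) (p / q)"
proof -
  have "epowr (weak_Lp_norm p X f) (p / q) =
      epowr (SUP t \<in> {0::real<..}. ennreal t * emeasure lebesgue {x \<in> X. \<bar>f x\<bar> powr p > t}) (1 / q)"
    using assms by (simp add: weak_Lp_norm_def lorentz_norm_def epowr_epowr)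
  then show ?thesis using assms by (simp only:) (intro SUP_least epowr_mono SUP_upper; simp)
qed

theorem theorem1p6:
  fixes p q :: real and \<gamma> :: ennreal
  assumes "0 < p" and "p < q" and "0 < \<gamma>"
  shows "\<exists>C\<^sub>1 C\<^sub>2 C\<^sub>3 :: real. 0 < C\<^sub>1 \<and> 0 < C\<^sub>2 \<and> 0 < C\<^sub>3 \<and>
    (\<forall>(Q :: (real ^ 'n) set) u. is_cube Q \<longrightarrow> u \<in> BMO Q \<longrightarrow>
       lorentz_norm q \<gamma> Q (\<lambda>x. u x - mean Q u)
         \<le> ennreal C\<^sub>1 * lorentz_norm q \<gamma> Q (\<lambda>x. min \<bar>u x - mean Q u\<bar> (enn2real (bmo_norm Q u)))
       \<and>
       ennreal C\<^sub>1 * lorentz_norm q \<gamma> Q (\<lambda>x. min \<bar>u x - mean Q u\<bar> (enn2real (bmo_norm Q u)))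
         \<le> ennreal C\<^sub>2
             * (SUP s \<in> {s :: real. 0 < s \<and> ennreal s \<le> epowr (bmo_norm Q u) p}.
                  epowr (ennreal s * emeasure lebesgue {x \<in> Q. \<bar>u x - mean Q u\<bar> powr p > s}) (1 / q))
             * epowr (bmo_norm Q u) (1 - p / q)
       \<and>
       ennreal C\<^sub>2
             * (SUP s \<in> {s :: real. 0 < s \<and> ennreal s \<le> epowr (bmo_norm Q u) p}.
                  epowr (ennreal s * emeasure lebesgue {x \<in> Q. \<bar>u x - mean Q u\<bar> powr p > s}) (1 / q))
             * epowr (bmo_norm Q u) (1 - p / q)
         \<le> ennreal C\<^sub>3
             * epowr (weak_Lp_norm p Q (\<lambda>x. u x - mean Q u)) (p / q)
             * epowr (bmo_norm Q u) (1 - p / q))"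
proof -
  have q: "0 < q" using assms by simp
  obtain C1 where C1: "0 < C1"
    "\<And>(Q :: (real^'n) set) u. is_cube Q \<Longrightarrow> u \<in> BMO Q \<Longrightarrow>
       lorentz_norm q \<gamma> Q (\<lambda>x. u x - mean Q u)
         \<le> ennreal C1 * lorentz_norm q \<gamma> Q (\<lambda>x. min \<bar>u x - mean Q u\<bar> (enn2real (bmo_norm Q u)))"
    by (rule lorentz_norm_le_truncation[OF q assms(3), where 'n = 'n]) blast
  obtain C where C: "0 < C"
    "\<And>(Q :: (real^'n) set) u. is_cube Q \<Longrightarrow> u \<in> BMO Q \<Longrightarrow>
       lorentz_norm q \<gamma> Q (\<lambda>x. min \<bar>u x - mean Q u\<bar> (enn2real (bmo_norm Q u)))
         \<le> ennreal C
             * (SUP s \<in> {s :: real. 0 < s \<and> ennreal s \<le> epowr (bmo_norm Q u) p}.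
                  epowr (ennreal s * emeasure lebesgue {x \<in> Q. \<bar>u x - mean Q u\<bar> powr p > s}) (1 / q))
             * epowr (bmo_norm Q u) (1 - p / q)"
    by (rule lorentz_norm_truncation_le_weak[OF assms, where 'n = 'n]) blast
  have C12: "ennreal (C1 * C) = ennreal C1 * ennreal C" using C1 C by (simp add: ennreal_mult)
  show ?thesis
  \<comment> \<open>The last inequality holds with factor 1, so \<open>C\<^sub>2\<close> and
    \<open>C\<^sub>3\<close> may coincide.\<close>
  proof (rule exI[of _ C1], rule exI[of _ "C1 * C"], rule exI[of _ "C1 * C"], intro conjI allI impI)
    fix Q :: "(real^'n) set" and u assume Q: "is_cube Q" and u: "u \<in> BMO Q"
    show "lorentz_norm q \<gamma> Q (\<lambda>x. u x - mean Q u)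
         \<le> ennreal C1 * lorentz_norm q \<gamma> Q (\<lambda>x. min \<bar>u x - mean Q u\<bar> (enn2real (bmo_norm Q u)))"
      using C1(2)[OF Q u] .
    show "ennreal C1 * lorentz_norm q \<gamma> Q (\<lambda>x. min \<bar>u x - mean Q u\<bar> (enn2real (bmo_norm Q u)))
         \<le> ennreal (C1 * C)
             * (SUP s \<in> {s :: real. 0 < s \<and> ennreal s \<le> epowr (bmo_norm Q u) p}.
                  epowr (ennreal s * emeasure lebesgue {x \<in> Q. \<bar>u x - mean Q u\<bar> powr p > s}) (1 / q))
             * epowr (bmo_norm Q u) (1 - p / q)"
      using mult_left_mono[OF C(2)[OF Q u], of "ennreal C1"] by (simp add: C12 mult.assoc)
    show "ennreal (C1 * C)
             * (SUP s \<in> {s :: real. 0 < s \<and> ennreal s \<le> epowr (bmo_norm Q u) p}.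
                  epowr (ennreal s * emeasure lebesgue {x \<in> Q. \<bar>u x - mean Q u\<bar> powr p > s}) (1 / q))
             * epowr (bmo_norm Q u) (1 - p / q)
         \<le> ennreal (C1 * C)
             * epowr (weak_Lp_norm p Q (\<lambda>x. u x - mean Q u)) (p / q)
             * epowr (bmo_norm Q u) (1 - p / q)"
      by (intro mult_right_mono mult_left_mono SUP_epowr_le_weak_Lp_norm assms q) auto
  qed (use C1 C in auto)
qed

end
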